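(* Let $r\ge0$, $q=r+1$, $p\ge1$, and let $\tau\to+\infty$. Let $a_\nu(\tau)$ ($1\le\nu\le q$), $b_h(\tau)$ ($1\le h\le r$) satisfy, for all large $\tau$, $a_\nu(\tau)>-1$, $b_h(\tau)>a_h(\tau)$. Put $\varepsilon_\tau=\sqrt{2/\tau}$, $c_\tau=\tau$, $x_\tau(t)=c_\tau(1+\varepsilon_\tau t)$. Assume $a_q(\tau)+1=\tau+\sqrt{2\tau}\,\widehat a_*+\mathrm O(1)$, and $\varepsilon_\tau(a_h(\tau)+1)\to\rho_h>0$, $b_h(\tau)-a_h(\tau)\to d_h\ge0$ for $1\le h\le r$. Suppose additionally that real exponents $\beta_i(\tau)$ satisfy $$\varepsilon_\tau\beta_i(\tau)\to\xi_i,\qquad\xi_i+\rho_h>0\quad(1\le i\le p,\ 1\le h\le r).$$ Then, locally uniformly for $t$ in compact subsets of $\mathbb R$, $$c_\tau^{-\beta_i(\tau)}x_\tau(t)^{\beta_i(\tau)}=(1+\varepsilon_\tau t)^{\beta_i(\tau)}\xrightarrow[\tau\to+\infty]{}\mathrm e^{\xi_it}.$$ After the row normalizations $\widehat U_{j,\tau}$ (see context) and multiplication of the $i$-th column $x^{\beta_i(\tau)}$ by $c_\tau^{-\beta_i(\tau)}$, the matrix of measures converges in every fixed mixed-type moment to the matrix generated by the row vector $(K_{\rho_1,1}F,\dots,K_{\rho_r,1}F,F)$ and the column vector $(\mathrm e^{\xi_1t},\dots,\mathrm e^{\xi_pt})$: for every fixed $m\in\mathbb N_0$, $1\le i\le p$,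 $1\le j\le r+1$, $$\int_{-\varepsilon_\tau^{-1}}^\infty t^m(1+\varepsilon_\tau t)^{\beta_i(\tau)}\widehat U_{j,\tau}(t)\,\mathrm dt\xrightarrow[\tau\to+\infty]{}\int_{\mathbb R}t^m\mathrm e^{\xi_it}U_j^{\mathrm H}(t)\,\mathrm dt.$$
   Context: $\mathcal B_{a,b}(x)=\frac{x^a(1-x)^{b-a-1}}{\Gamma(b-a)}\mathbf 1_{(0,1)}(x)$ ($-1<a<b$); $\mathcal G_a(x)=x^a\mathrm e^{-x}\mathbf 1_{(0,\infty)}(x)$; Mellin convolution $(f*g)(x)=\int_0^\infty f(u)g(x/u)\frac{\mathrm du}u$. $w_{0,\tau}=\mathcal B_{a_1(\tau),b_1(\tau)}*\cdots*\mathcal B_{a_r(\tau),b_r(\tau)}*\mathcal G_{a_q(\tau)}$; $w_{h,\tau}$ is the same with $b_h(\tau)$ replaced by $b_h(\tau)+1$. $Z_\tau=\int_0^\infty w_{0,\tau}(x)\,\mathrm dx$, $Z_{h,\tau}=Z_\tau/(b_h(\tau)+1)$. Normalized rows: $\widehat U_{h,\tau}(t)=\frac{c_\tau\varepsilon_\tau}{Z_{h,\tau}}w_{h,\tau}(x_\tau(t))$ for $1\le h\le r$, $\widehat U_{q,\tau}(t)=\frac{c_\tau\varepsilon_\tau}{Z_\tau}w_{0,\tau}(x_\tau(t))$. $\phi_a(t)=\pi^{-1/2}\mathrm e^{-(t-a)^2}$; $(K_{\rho,d}f)(t)=\int_0^\infty\frac{\rho^d}{\Gamma(d)}u^{d-1}\mathrm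 e^{-\rho u}f(t+u)\,\mathrm du$ for $\rho,d>0$, $K_{\rho,0}=I$; $F=K_{\rho_1,d_1}\cdots K_{\rho_r,d_r}\phi_{\widehat a_*}$; $U_j^{\mathrm H}=K_{\rho_j,1}F$ for $1\le j\le r$ and $U_q^{\mathrm H}=F$. *)

theory Defs
  imports "HOL-Analysis.Analysis" "HOL-Library.Landau_Symbols"
begin

definition beta_kernel :: "real \<Rightarrow> real \<Rightarrow> real \<Rightarrow> real" where
  "beta_kernel a b x =
     x powr a * (1 - x) powr (b - a - 1) / Gamma (b - a) * indicator {0<..<1} x"

definition gamma_weight :: "real \<Rightarrow> real \<Rightarrow> real" where
  "gamma_weight a x = x powr a * exp (- x) * indicator {0<..} x"

definition mellin_conv :: "(real \<Rightarrow> real) \<Rightarrow> (real \<Rightarrow> real) \<Rightarrow> real \<Rightarrow> real" where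
  "mellin_conv f g x = (LINT u:{0<..}|lborel. f u * g (x / u) / u)"

text \<open>
  The convolution product is bracketed to the right, with the gamma weight innermost, so that
  every intermediate convolution is finite at every point \<open>x > 0\<close>.  Indices run from \<open>1\<close>;
  the gamma weight has index \<open>q = Suc r\<close>.
\<close>

definition weight :: "nat \<Rightarrow> (nat \<Rightarrow> real) \<Rightarrow> (nat \<Rightarrow> real) \<Rightarrow> real \<Rightarrow> real" where
  "weight r a b =
     foldr (\<lambda>h. mellin_conv (beta_kernel (a h) (b h))) [1..<Suc r] (gamma_weight (a (Suc r)))"

definition weight_raised ::
    "nat \<Rightarrow> (nat \<Rightarrow> real) \<Rightarrow> (nat \<Rightarrow> real) \<Rightarrow> nat \<Rightarrow> real \<Rightarrow> real" where
  "weight_raised r a b h = weight r a (b(h := b h + 1))"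

definition weight_mass :: "nat \<Rightarrow> (nat \<Rightarrow> real) \<Rightarrow> (nat \<Rightarrow> real) \<Rightarrow> real" where
  "weight_mass r a b = (LINT x:{0<..}|lborel. weight r a b x)"

definition weight_raised_mass ::
    "nat \<Rightarrow> (nat \<Rightarrow> real) \<Rightarrow> (nat \<Rightarrow> real) \<Rightarrow> nat \<Rightarrow> real" where
  "weight_raised_mass r a b h = weight_mass r a b / (b h + 1)"

definition eps :: "real \<Rightarrow> real" where
  "eps \<tau> = sqrt (2 / \<tau>)"

definition centre :: "real \<Rightarrow> real" where
  "centre \<tau> = \<tau>"

definition zoom :: "real \<Rightarrow> real \<Rightarrow> real" where
  "zoom \<tau> t = centre \<tau> * (1 + eps \<tau> * t)"

text \<open>Rows \<open>1, \<dots>, r\<close> come from the raised weights, row \<open>q = Suc r\<close> from the base weight.\<close>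

definition row_hat ::
    "nat \<Rightarrow> (nat \<Rightarrow> real \<Rightarrow> real) \<Rightarrow> (nat \<Rightarrow> real \<Rightarrow> real) \<Rightarrow> nat \<Rightarrow> real \<Rightarrow> real \<Rightarrow> real" where
  "row_hat r a b j \<tau> t =
     (let a\<tau> = (\<lambda>\<nu>. a \<nu> \<tau>); b\<tau> = (\<lambda>h. b h \<tau>) in
      if j \<le> r
      then centre \<tau> * eps \<tau> / weight_raised_mass r a\<tau> b\<tau> j * weight_raised r a\<tau> b\<tau> j (zoom \<tau> t)
      else centre \<tau> * eps \<tau> / weight_mass r a\<tau> b\<tau> * weight r a\<tau> b\<tau> (zoom \<tau> t))"

definition gauss :: "real \<Rightarrow> real \<Rightarrow> real" where
  "gauss a t = pi powr (- 1 / 2) * exp (- ((t - a)\<^sup>2))"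

definition K_op :: "real \<Rightarrow> real \<Rightarrow> (real \<Rightarrow> real) \<Rightarrow> real \<Rightarrow> real" where
  "K_op \<rho> d f t =
     (if d = 0 then f t
      else (LINT u:{0<..}|lborel.
              \<rho> powr d / Gamma d * u powr (d - 1) * exp (- \<rho> * u) * f (t + u)))"

definition F_lim :: "nat \<Rightarrow> (nat \<Rightarrow> real) \<Rightarrow> (nat \<Rightarrow> real) \<Rightarrow> real \<Rightarrow> real \<Rightarrow> real" where
  "F_lim r \<rho> d a = foldr (\<lambda>h. K_op (\<rho> h) (d h)) [1..<Suc r] (gauss a)"

definition row_lim ::
    "nat \<Rightarrow> (nat \<Rightarrow> real) \<Rightarrow> (nat \<Rightarrow> real) \<Rightarrow> real \<Rightarrow> nat \<Rightarrow> real \<Rightarrow> real" where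
  "row_lim r \<rho> d a j =
     (if j \<le> r then K_op (\<rho> j) 1 (F_lim r \<rho> d a) else F_lim r \<rho> d a)"

end

theory Submission
  imports Defs "HOL-Probability.Distributions" "HOL-Real_Asymp.Real_Asymp"
begin

text \<open>
  Both sides are compared moment by moment.  Writing \<open>x = \<tau> (1 + \<epsilon> t)\<close>, a Mellin convolution with a
  kernel supported on \<open>(0, 1)\<close> replaces \<open>t\<close> by \<open>u t - v\<close> with \<open>u = 1 - \<epsilon> v\<close>; binomial
  expansion therefore expresses the moments \<open>t\<^sup>m (x / \<tau>) powr \<beta>\<close> of the convolution through products of
  moments of the two factors.  The beta factors are explicit quotients of Gamma functions and converge to the
  moments of exponentially tilted gamma laws; the gamma factor satisfies a three-term recurrence that converges
  to the Hermite recurrence of the Gaussian.  The operators \<open>K_op\<close> act on the moments of the limit by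
  the same binomial rule.  Encoded as exponential generating functions (\<open>moment_fps\<close>), all these actions become
  commuting multiplications, and raising \<open>b\<^sub>j\<close> by one multiplies the limit series by the factor of
  \<open>K_op (\<rho> j) 1\<close>.
\<close>

subsection \<open>Moments of convolutions\<close>

text \<open>Working with moments avoids pointwise asymptotics of the rows. It also covers
  \<open>d h = 0\<close>, where the normalized beta kernel collapses to a point mass: the factor
  \<open>pochhammer (b - a) k\<close> then makes the higher moments vanish. The binomial expansion
  leaves \<open>u ^ (m - k)\<close> beside the kernel; it is absorbed by raising \<beta> by
  \<open>m - k\<close>, which is invisible in the limit because \<open>eps \<tau> * (m - k)\<close>
  tends to 0. The gamma factor cannot be treated by expanding \<open>(x - \<tau>) ^ m\<close>: this
  gives an alternating sum of Gamma quotients whose leading orders cancel, so termwise limits say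
  nothing. Its recurrence, in contrast, has coefficients that converge after rescaling, and only the
  moment of order 0 goes through Stirling's formula. The beta factors show no such cancellation,
  because powers of \<open>1 - u\<close> merge with the kernel.\<close>

lemma affine_fubini:
  fixes f g P c s :: "real \<Rightarrow> real"
  assumes [measurable]: "f \<in> borel_measurable borel" "g \<in> borel_measurable borel"
      "P \<in> borel_measurable borel" "c \<in> borel_measurable borel" "s \<in> borel_measurable borel"
    and pos: "\<And>u. f u \<noteq> 0 \<Longrightarrow> c u > 0"
    and int: "integrable (lborel \<Otimes>\<^sub>M lborel) (\<lambda>(u, y). f u * g y * P (s u + c u * y))"
  shows "integrable lborel (\<lambda>x. P x * (\<integral>u. f u * g ((x - s u) / c u) / c u \<partial>lborel))"
    and "(\<integral>x. P x * (\<integral>u. f u * g ((x - s u) / c u) / c u \<partial>lborel) \<partial>lborel)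
       = (\<integral>u. (\<integral>y. f u * g y * P (s u + c u * y) \<partial>lborel) \<partial>lborel)"
proof -
  \<comment> \<open>For fixed \<open>u\<close> with \<open>f u \<noteq> 0\<close> the substitution
    \<open>x = s u + c u * y\<close> has Jacobian \<open>c u\<close>, which cancels the division by
    \<open>c u\<close> in \<open>H\<close>. Where \<open>f u = 0\<close> both sides vanish, hence
    positivity of \<open>c u\<close> is asked only off the zeros of \<open>f\<close>.\<close>
  define H where "H = (\<lambda>u x. P x * (f u * g ((x - s u) / c u) / c u))"
  have [measurable]: "(\<lambda>(u, x). H u x) \<in> borel_measurable (lborel \<Otimes>\<^sub>M lborel)"
    unfolding H_def by measurable
  have subst_eq: "(\<integral>x. \<phi> (H u x) \<partial>lborel) = \<bar>c u\<bar> * (\<integral>y. \<phi> (H u (s u + c u * y)) \<partial>lborel)"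
    if "f u \<noteq> 0" for u and \<phi> :: "real \<Rightarrow> real"
    using pos[OF that] lborel_integral_real_affine[of "c u" "\<lambda>x. \<phi> (H u x)" "s u"] by simp
  have H_subst: "H u (s u + c u * y) = (f u * g y * P (s u + c u * y)) / c u" if "f u \<noteq> 0" for u y
    using pos[OF that] by (simp add: H_def field_simps)
  have norm_eq: "(\<integral>x. norm (H u x) \<partial>lborel) = (\<integral>y. norm (f u * g y * P (s u + c u * y)) \<partial>lborel)" for u
  proof (cases "f u = 0")
    case True
    then show ?thesis by (simp add: H_def)
  next
    case False
    then show ?thesis
      using pos[OF False] subst_eq[OF False, of norm] by (simp add: H_subst abs_mult)
  qed
  have int_eq: "(\<integral>x. H u x \<partial>lborel) = (\<integral>y. f u * g y * P (s u + c u * y) \<partial>lborel)" for u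
  proof (cases "f u = 0")
    case True
    then show ?thesis by (simp add: H_def)
  next
    case False
    then show ?thesis
      using pos[OF False] subst_eq[OF False, of "\<lambda>x. x"] by (simp add: H_subst)
  qed
  have "AE u in lborel. integrable lborel (\<lambda>y. f u * g y * P (s u + c u * y))"
    using lborel_pair.AE_integrable_fst'[OF int] by simp
  then have AE_H: "AE u in lborel. integrable lborel (\<lambda>x. H u x)"
  proof eventually_elim
    case (elim u)
    show ?case
    proof (cases "f u = 0")
      case True
      then show ?thesis by (simp add: H_def)
    next
      case False
      have "integrable lborel (\<lambda>y. H u (s u + c u * y))"
        unfolding H_subst[OF False] using elim by simp
      then show ?thesis
        using pos[OF False] by (subst (asm) lborel_integrable_real_affine_iff) auto
    qed
  qed
  have int_norm: "integrable lborel (\<lambda>u. \<integral>x. norm (H u x) \<partial>lborel)"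
    using lborel_pair.integrable_fst'[OF integrable_norm[OF int]] unfolding norm_eq
    by (simp add: split_def)
  have H_int: "integrable (lborel \<Otimes>\<^sub>M lborel) (\<lambda>(u, x). H u x)"
    by (rule lborel_pair.Fubini_integrable) (use AE_H int_norm in auto)
  have H_P: "(\<integral>u. H u x \<partial>lborel) = P x * (\<integral>u. f u * g ((x - s u) / c u) / c u \<partial>lborel)" for x
    unfolding H_def by (rule integral_mult_right_zero)
  show "integrable lborel (\<lambda>x. P x * (\<integral>u. f u * g ((x - s u) / c u) / c u \<partial>lborel))"
    using lborel_pair.integrable_snd[OF H_int] by (simp only: H_P)
  show "(\<integral>x. P x * (\<integral>u. f u * g ((x - s u) / c u) / c u \<partial>lborel) \<partial>lborel)
       = (\<integral>u. (\<integral>y. f u * g y * P (s u + c u * y) \<partial>lborel) \<partial>lborel)"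
    using lborel_pair.Fubini_integral[OF H_int] by (simp only: H_P int_eq)
qed

lemma integrable_pair_mult:
  fixes f g :: "real \<Rightarrow> real"
  assumes f: "integrable lborel f" and g: "integrable lborel g"
  shows "integrable (lborel \<Otimes>\<^sub>M lborel) (\<lambda>(u, y). f u * g y)"
proof (rule lborel_pair.Fubini_integrable)
  have [measurable]: "f \<in> borel_measurable borel" "g \<in> borel_measurable borel"
    using f g by (auto dest: borel_measurable_integrable)
  show "(\<lambda>(u, y). f u * g y) \<in> borel_measurable (lborel \<Otimes>\<^sub>M lborel)"
    by measurable
qed (use f g in \<open>auto simp: abs_mult\<close>)

text \<open>Serves the Mellin convolution (\<open>c u = u\<close>, \<open>s u = 0\<close>) and the
  shift in \<open>K_op\<close> (\<open>c u = 1\<close>, \<open>s u = - u\<close>) alike. The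
  expansion writes the integrand as a finite sum of functions with separated variables, which gives
  integrability on the product and the value term by term. \<open>A\<close> may depend on
  \<open>m\<close>, which the Mellin case exploits.\<close>

lemma moment_convolution:
  fixes f g c s :: "real \<Rightarrow> real" and P A :: "nat \<Rightarrow> real \<Rightarrow> real"
  assumes [measurable]: "f \<in> borel_measurable borel" "g \<in> borel_measurable borel"
      "P m \<in> borel_measurable borel" "c \<in> borel_measurable borel" "s \<in> borel_measurable borel"
    and pos: "\<And>u. f u \<noteq> 0 \<Longrightarrow> c u > 0"
    and expand: "\<And>u y. f u \<noteq> 0 \<Longrightarrow>
        P m (s u + c u * y) = (\<Sum>k\<le>m. of_nat (m choose k) * A k u * P (m - k) y)"
    and f_int: "\<And>k. k \<le> m \<Longrightarrow> integrable lborel (\<lambda>u. f u * A k u)"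
    and g_int: "\<And>k. k \<le> m \<Longrightarrow> integrable lborel (\<lambda>y. P k y * g y)"
  shows "integrable lborel (\<lambda>x. P m x * (\<integral>u. f u * g ((x - s u) / c u) / c u \<partial>lborel))"
    and "(\<integral>x. P m x * (\<integral>u. f u * g ((x - s u) / c u) / c u \<partial>lborel) \<partial>lborel)
       = (\<Sum>k\<le>m. of_nat (m choose k) * (\<integral>u. f u * A k u \<partial>lborel) * (\<integral>y. P (m - k) y * g y \<partial>lborel))"
proof -
  have eq: "f u * g y * P m (s u + c u * y)
      = (\<Sum>k\<le>m. of_nat (m choose k) * ((f u * A k u) * (P (m - k) y * g y)))" for u y
  proof (cases "f u = 0")
    case False
    show ?thesis
      unfolding expand[OF False] sum_distrib_left by (simp add: mult_ac)
  qed simp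
  have int: "integrable (lborel \<Otimes>\<^sub>M lborel) (\<lambda>(u, y). f u * g y * P m (s u + c u * y))"
    unfolding eq split_def
    by (intro Bochner_Integration.integrable_sum integrable_mult_right
        integrable_pair_mult[unfolded split_def] f_int g_int) auto
  show "integrable lborel (\<lambda>x. P m x * (\<integral>u. f u * g ((x - s u) / c u) / c u \<partial>lborel))"
    by (rule affine_fubini(1)[OF _ _ _ _ _ pos int]) auto
  have "(\<integral>x. P m x * (\<integral>u. f u * g ((x - s u) / c u) / c u \<partial>lborel) \<partial>lborel)
      = (\<integral>u. (\<integral>y. f u * g y * P m (s u + c u * y) \<partial>lborel) \<partial>lborel)"
    by (rule affine_fubini(2)[OF _ _ _ _ _ pos int]) auto
  also have "\<dots> = (\<integral>u. (\<Sum>k\<le>m. of_nat (m choose k) * ((f u * A k u) * (\<integral>y. P (m - k) y * g y \<partial>lborel))) \<partial>lborel)"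
    unfolding eq using g_int by (subst Bochner_Integration.integral_sum) auto
  also have "\<dots> = (\<Sum>k\<le>m. (\<integral>u. of_nat (m choose k) * ((f u * A k u) * (\<integral>y. P (m - k) y * g y \<partial>lborel)) \<partial>lborel))"
    by (intro Bochner_Integration.integral_sum integrable_mult_right integrable_mult_left f_int) auto
  also have "\<dots> = (\<Sum>k\<le>m. of_nat (m choose k) * (\<integral>u. f u * A k u \<partial>lborel) * (\<integral>y. P (m - k) y * g y \<partial>lborel))"
    by (simp only: integral_mult_right_zero integral_mult_left_zero) (simp only: mult.assoc)
  finally show "(\<integral>x. P m x * (\<integral>u. f u * g ((x - s u) / c u) / c u \<partial>lborel) \<partial>lborel)
       = (\<Sum>k\<le>m. of_nat (m choose k) * (\<integral>u. f u * A k u \<partial>lborel) * (\<integral>y. P (m - k) y * g y \<partial>lborel))" .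
qed

subsection \<open>Asymptotics of Gamma quotients\<close>

text \<open>The mean value theorem for \<open>ln_Gamma\<close> on \<open>[x, x + 1]\<close> gives
  \<open>ln x = Digamma c\<close> for an intermediate \<open>c\<close>; monotonicity and
  \<open>Digamma (x + 1) = Digamma x + 1 / x\<close> enclose it.\<close>

lemma Digamma_ln_bounds:
  assumes "x > (0::real)"
  shows "Digamma x \<le> ln x" and "ln x - 1 / x \<le> Digamma x"
proof -
  obtain c where c: "x < c" "c < x + 1" and
    eq: "ln_Gamma (x + 1) - ln_Gamma x = (x + 1 - x) * Digamma c"
    using MVT2[of x "x + 1" ln_Gamma Digamma] assms has_field_derivative_ln_Gamma_real
    by (metis add_increasing2 less_add_one not_le order_less_le_trans zero_less_one)
  have "ln (Gamma (x + 1)) = ln x + ln (Gamma x)"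
    using assms Gamma_real_pos[of x] by (subst Gamma_plus1) (auto simp: ln_mult_pos elim!: nonpos_Ints_cases)
  then have "ln x = Digamma c"
    using eq assms by (simp add: ln_Gamma_real_pos)
  moreover have "Digamma x \<le> Digamma c" "Digamma c \<le> Digamma (x + 1)"
    using c assms by (auto intro!: Digamma_real_mono)
  ultimately show "Digamma x \<le> ln x" "ln x - 1 / x \<le> Digamma x"
    using assms Digamma_plus1[of x] by auto
qed

text \<open>\<open>G\<close> is what remains of \<open>ln_Gamma\<close> after the leading part of
  Stirling's formula. Its derivative \<open>Digamma z - ln z\<close> lies between
  \<open>- 1 / z\<close> and \<open>0\<close>, so \<open>G\<close> hardly changes between arguments
  of ratio near 1. Only differences enter later, where Stirling's constant cancels.\<close>

lemma ln_Gamma_diff_bound: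
  fixes x y :: real
  defines "G \<equiv> \<lambda>x. ln_Gamma x - (x * ln x - x)"
  assumes "x > 0" "y > 0"
  shows "\<bar>G y - G x\<bar> \<le> \<bar>y - x\<bar> / min x y"
proof -
  have *: "\<bar>G v - G u\<bar> \<le> (v - u) / u" if "0 < u" "u < v" for u v
  proof -
    have "\<exists>z. u < z \<and> z < v \<and> G v - G u = (v - u) * (Digamma z - ln z)"
    proof (rule MVT2)
      fix z assume "u \<le> z" "z \<le> v"
      then have "z > 0" using that by simp
      then show "(G has_real_derivative Digamma z - ln z) (at z)"
        unfolding G_def by (auto intro!: derivative_eq_intros)
    qed (use that in auto)
    then obtain z where z: "u < z" "z < v" "G v - G u = (v - u) * (Digamma z - ln z)" by blast
    have "\<bar>Digamma z - ln z\<bar> \<le> 1 / z"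
      using Digamma_ln_bounds[of z] z that by auto
    also have "\<dots> \<le> 1 / u" using z that by (simp add: field_simps)
    finally have "\<bar>G v - G u\<bar> \<le> (v - u) * (1 / u)"
      unfolding z(3) abs_mult using that by (intro mult_mono) auto
    then show ?thesis by simp
  qed
  show ?thesis
    using *[of x y] *[of y x] assms by (cases x y rule: linorder_cases) (auto simp: abs_minus_commute min_def)
qed

text \<open>Second-order Taylor quotient of \<open>(1 + z) * ln (1 + z)\<close> at 0, completed by
  half the second derivative. It separates the scale \<open>\<delta>\<^sup>2 / x\<close> of the
  surviving term from a factor that tends to \<open>1 / 2\<close>.\<close>

definition log_excess :: "real \<Rightarrow> real" where
  "log_excess z = (if z = 0 then 1 / 2 else ((1 + z) * ln (1 + z) - z) / z\<^sup>2)"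

lemma log_excess_eq: "(1 + z) * ln (1 + z) - z = z\<^sup>2 * log_excess z"
  by (simp add: log_excess_def)

lemma log_excess_tendsto: "log_excess \<midarrow>0\<rightarrow> 1 / 2"
proof -
  have "((\<lambda>z::real. ((1 + z) * ln (1 + z) - z) / z\<^sup>2) \<longlongrightarrow> 1 / 2) (at 0)"
    unfolding filterlim_at_split by (intro conjI; real_asymp)
  then show ?thesis
    by (rule Lim_transform_eventually) (auto simp: log_excess_def eventually_at_filter)
qed

lemma isCont_log_excess: "isCont log_excess 0"
  using log_excess_tendsto by (simp add: isCont_def log_excess_def)

text \<open>The limit \<open>L\<close> is nonzero for shifts of order \<open>sqrt x\<close>; it is the surviving quadratic term of
  Stirling's formula.\<close>

lemma Gamma_quotient_tendsto:
  fixes x \<delta> :: "'a \<Rightarrow> real"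
  assumes x: "filterlim x at_top F" and \<delta>: "((\<lambda>t. (\<delta> t)\<^sup>2 / x t) \<longlongrightarrow> L) F"
  shows "\<forall>\<^sub>F t in F. x t > 0 \<and> x t + \<delta> t > 0"
    and "((\<lambda>t. Gamma (x t + \<delta> t) / (Gamma (x t) * x t powr \<delta> t)) \<longlongrightarrow> exp (L / 2)) F"
proof -
  define z where "z = (\<lambda>t. \<delta> t / x t)"
  have x_pos: "\<forall>\<^sub>F t in F. x t > 0"
    using x by (simp add: filterlim_at_top_dense)
  \<comment> \<open>\<open>z\<^sup>2\<close> is \<open>\<delta>\<^sup>2 / x\<close> divided by
    \<open>x\<close>, so a convergent quadratic term already forces the relative shift
    \<open>z\<close> to 0.\<close>
  have "((\<lambda>t. (\<delta> t)\<^sup>2 / x t * inverse (x t)) \<longlongrightarrow> L * 0) F"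
    by (intro tendsto_mult \<delta> tendsto_inverse_0_at_top[OF x])
  then have "((\<lambda>t. (z t)\<^sup>2) \<longlongrightarrow> 0) F"
    by (simp add: z_def power2_eq_square field_simps)
  then have "((\<lambda>t. sqrt ((z t)\<^sup>2)) \<longlongrightarrow> sqrt 0) F"
    by (rule tendsto_real_sqrt)
  then have z: "(z \<longlongrightarrow> 0) F"
    by (simp add: tendsto_rabs_zero_iff)
  have z_small: "\<forall>\<^sub>F t in F. \<bar>z t\<bar> < 1 / 2"
    using order_tendstoD(2)[OF tendsto_rabs_zero[OF z], of "1 / 2"] by simp
  have shift: "x t + \<delta> t = x t * (1 + z t)" if "x t > 0" for t
    using that by (simp add: z_def field_simps)
  show pos: "\<forall>\<^sub>F t in F. x t > 0 \<and> x t + \<delta> t > 0"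
    using x_pos z_small
  proof eventually_elim
    case (elim t)
    then have "0 < 1 + z t" by linarith
    with elim show ?case by (metis shift mult_pos_pos)
  qed
  define G where "G = (\<lambda>x::real. ln_Gamma x - (x * ln x - x))"
  have "((\<lambda>t. G (x t + \<delta> t) - G (x t)) \<longlongrightarrow> 0) F"
  proof (rule Lim_null_comparison)
    show "((\<lambda>t. 2 * \<bar>z t\<bar>) \<longlongrightarrow> 0) F"
      by (intro tendsto_mult_right_zero tendsto_rabs_zero z)
    show "\<forall>\<^sub>F t in F. norm (G (x t + \<delta> t) - G (x t)) \<le> 2 * \<bar>z t\<bar>"
      using x_pos z_small
    proof eventually_elim
      case (elim t)
      then have "x t * (1 / 2) \<le> x t * (1 + z t)" by (intro mult_left_mono) linarith+
      then have half: "x t / 2 \<le> x t + \<delta> t" using elim by (simp add: shift)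
      have "\<bar>G (x t + \<delta> t) - G (x t)\<bar> \<le> \<bar>x t + \<delta> t - x t\<bar> / min (x t) (x t + \<delta> t)"
        unfolding G_def using elim half by (intro ln_Gamma_diff_bound) auto
      also have "\<dots> \<le> \<bar>\<delta> t\<bar> / (x t / 2)"
        using elim half by (intro frac_le) auto
      also have "\<dots> = 2 * \<bar>z t\<bar>"
        using elim by (simp add: z_def)
      finally show ?case by simp
    qed
  qed
  moreover have "((\<lambda>t. (\<delta> t)\<^sup>2 / x t * log_excess (z t)) \<longlongrightarrow> L * (1 / 2)) F"
    using isCont_tendsto_compose[OF isCont_log_excess z]
    by (intro tendsto_mult \<delta>) (simp add: log_excess_def)
  ultimately have "((\<lambda>t. exp ((G (x t + \<delta> t) - G (x t)) + (\<delta> t)\<^sup>2 / x t * log_excess (z t)))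
      \<longlongrightarrow> exp (0 + L * (1 / 2))) F"
    by (intro tendsto_exp tendsto_add)
  then have lim: "((\<lambda>t. exp ((G (x t + \<delta> t) - G (x t)) + (\<delta> t)\<^sup>2 / x t * log_excess (z t)))
      \<longlongrightarrow> exp (L / 2)) F" by simp
  show "((\<lambda>t. Gamma (x t + \<delta> t) / (Gamma (x t) * x t powr \<delta> t)) \<longlongrightarrow> exp (L / 2)) F"
  proof (rule Lim_transform_eventually[OF lim])
    show "\<forall>\<^sub>F t in F. exp (G (x t + \<delta> t) - G (x t) + (\<delta> t)\<^sup>2 / x t * log_excess (z t))
        = Gamma (x t + \<delta> t) / (Gamma (x t) * x t powr \<delta> t)"
      using pos
    proof eventually_elim
      case (elim t)
      then have px: "x t > 0" and py: "x t + \<delta> t > 0" and z1: "1 + z t > 0"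
        using shift[of t] by (auto simp: zero_less_mult_iff)
      \<comment> \<open>With \<open>y = x * (1 + z)\<close> the leading part of Stirling's formula
        satisfies \<open>y ln y - y - (x ln x - x) = \<delta> ln x + x ((1 + z) ln (1 + z) -
        z)\<close>. The first term is the power \<open>x powr \<delta>\<close>, the second the
        quadratic term.\<close>
      have "(\<delta> t)\<^sup>2 / x t * log_excess (z t) = x t * ((z t)\<^sup>2 * log_excess (z t))"
        using px by (simp add: z_def power2_eq_square field_simps)
      also have "\<dots> = (x t + \<delta> t) * ln (1 + z t) - \<delta> t"
        unfolding log_excess_eq[symmetric] shift[OF px] using px
        by (simp add: z_def field_simps)
      finally have "G (x t + \<delta> t) - G (x t) + (\<delta> t)\<^sup>2 / x t * log_excess (z t)
          = ln_Gamma (x t + \<delta> t) - ln_Gamma (x t) - \<delta> t * ln (x t)"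
        using px z1 ln_mult_pos[of "x t" "1 + z t"] shift[OF px] by (simp add: G_def algebra_simps)
      then show ?case
        using px py by (simp add: exp_diff Gamma_real_pos_exp powr_def)
    qed
  qed
qed

subsection \<open>Moments of beta, gamma and normal densities\<close>

text \<open>In the variable \<open>t\<close> of \<open>zoom\<close> this is
  \<open>t ^ m * (1 + eps \<tau> * t) powr \<beta>\<close>, restricted to
  \<open>t > - 1 / eps \<tau>\<close>.\<close>

definition moment_test :: "real \<Rightarrow> real \<Rightarrow> nat \<Rightarrow> real \<Rightarrow> real" where
  "moment_test \<tau> \<beta> m x = ((x / \<tau> - 1) / eps \<tau>) ^ m * (x / \<tau>) powr \<beta> * indicator {0<..} x"

lemma borel_measurable_moment_test [measurable]: "moment_test \<tau> \<beta> m \<in> borel_measurable borel"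
  unfolding moment_test_def by measurable

lemma eps_pos: "\<tau> > 0 \<Longrightarrow> eps \<tau> > 0"
  by (simp add: eps_def)

text \<open>Source of the factor \<open>1 / 2\<close> in the rescaled gamma recurrence, and hence of
  the variance \<open>1 / 2\<close> that matches \<open>gauss\<close>.\<close>

lemma eps_square: "\<tau> > 0 \<Longrightarrow> \<tau> * (eps \<tau>)\<^sup>2 = 2"
  by (simp add: eps_def)

lemma eps_tendsto_0: "(eps \<longlongrightarrow> 0) at_top"
  unfolding eps_def by real_asymp

lemma eventually_eps_pos: "\<forall>\<^sub>F \<tau> in at_top. \<tau> > 0 \<and> eps \<tau> > 0"
  using eventually_gt_at_top[of 0] by eventually_elim (simp add: eps_pos)

lemma filterlim_at_top_of_eps:
  assumes "((\<lambda>\<tau>. eps \<tau> * g \<tau>) \<longlongrightarrow> c) at_top" "c > 0"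
  shows "filterlim g at_top at_top"
proof -
  have "filterlim (\<lambda>\<tau>. inverse (eps \<tau>)) at_top at_top"
    using eps_tendsto_0 eventually_eps_pos
    by (intro filterlim_inverse_at_top) (auto elim: eventually_mono)
  from filterlim_tendsto_pos_mult_at_top[OF assms this] show ?thesis
    by (rule filterlim_mono_eventually)
      (use eventually_eps_pos in \<open>auto elim!: eventually_mono simp: field_simps\<close>)
qed

text \<open>Euler's beta integral after \<open>(1 - u) ^ k\<close> and \<open>u powr s\<close> merge
  with the kernel. The quotient \<open>Gamma (b - a + k) / Gamma (b - a)\<close> is kept as a
  Pochhammer symbol, which stays continuous when \<open>b - a\<close> tends to 0.\<close>

lemma beta_moment:
  fixes a b s e :: real
  assumes "a < b" "a + s + 1 > 0"
  shows "has_bochner_integral lborel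
      (\<lambda>u. indicator {0<..} u * beta_kernel a b u * (((1 - u) / e) ^ k * u powr s))
      (Gamma (a + s + 1) * pochhammer (b - a) k / Gamma (b + s + 1 + k) / e ^ k)"
proof -
  have d: "b - a > 0" and dk: "b - a + k > 0" using assms by auto
  define \<Phi> where "\<Phi> = (\<lambda>u::real. u powr (a + s + 1 - 1) * (1 - u) powr (b - a + k - 1))"
  have int: "set_integrable lborel {0..1} \<Phi>"
    unfolding \<Phi>_def by (rule integrable_Beta) (use assms dk in auto)
  have "(LINT u:{0..1}|lborel. \<Phi> u) = Beta (a + s + 1) (b - a + k)"
    using set_borel_integral_eq_integral(2)[OF int] has_integral_Beta_real[OF assms(2) dk]
    by (simp add: \<Phi>_def integral_unique)
  then have hb: "has_bochner_integral lborel (\<lambda>u. indicator {0..1} u *\<^sub>R \<Phi> u) (Beta (a + s + 1) (b - a + k))"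
    using int by (simp add: has_bochner_integral_iff set_integrable_def set_lebesgue_integral_def)
  have "indicator {0<..} u * beta_kernel a b u * (((1 - u) / e) ^ k * u powr s)
      = indicator {0..1} u *\<^sub>R \<Phi> u / (Gamma (b - a) * e ^ k)" for u
  proof (cases "u \<in> {0<..<1}")
    case True
    then have "\<Phi> u = u powr a * (1 - u) powr (b - a - 1) * ((1 - u) ^ k * u powr s)"
      by (simp add: \<Phi>_def powr_add powr_diff powr_realpow field_simps)
    then show ?thesis using True
      by (simp add: beta_kernel_def power_divide)
  next
    case False
    \<comment> \<open>The integral lives on the closed interval, the kernel on the open one; they
      agree because \<open>0 powr s = 0\<close> for every \<open>s\<close>.\<close>
    then have "indicator {0..1} u *\<^sub>R \<Phi> u = 0"
      by (cases "u = 0 \<or> u = 1") (auto simp: \<Phi>_def)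
    then show ?thesis using False by (simp add: beta_kernel_def)
  qed
  moreover have "Beta (a + s + 1) (b - a + k) / (Gamma (b - a) * e ^ k)
      = Gamma (a + s + 1) * pochhammer (b - a) k / Gamma (b + s + 1 + k) / e ^ k"
    using d by (subst pochhammer_Gamma) (auto simp: Beta_def add_ac elim!: nonpos_Ints_cases)
  ultimately show ?thesis
    using has_bochner_integral_divide_zero[OF hb, of "Gamma (b - a) * e ^ k"] by simp
qed

lemma gamma_integral:
  assumes "A > (0::real)"
  shows "has_bochner_integral lborel (\<lambda>x. indicator {0<..} x * (x powr (A - 1) * exp (- x))) (Gamma A)"
proof -
  have "has_bochner_integral lborel (\<lambda>t. indicator {0..} t * t powr (A - 1) / exp t) (Gamma A)"
  proof (rule has_bochner_integral_nn_integral)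
    show "(\<integral>\<^sup>+ t. ennreal (indicator {0..} t * t powr (A - 1) / exp t) \<partial>lborel) = ennreal (Gamma A)"
      using Gamma_conv_nn_integral_real[OF assms] by simp
  qed (use assms in \<open>auto simp: less_imp_le\<close>)
  moreover have "indicator {0..} t * t powr (A - 1) / exp t
      = indicator {0<..} t * (t powr (A - 1) * exp (- t))" for t :: real
    by (auto simp: indicator_def exp_minus field_simps)
  ultimately show ?thesis by simp
qed

section \<open>Three-term recurrence for centred gamma moments\<close>

definition gamma_centred :: "real \<Rightarrow> real \<Rightarrow> nat \<Rightarrow> real \<Rightarrow> real" where
  "gamma_centred \<tau> A k x = indicator {0<..} x * ((x - \<tau>) ^ k * (x powr (A - 1) * exp (- x)))"

lemma gamma_centred_Suc: "gamma_centred \<tau> A (Suc k) x = gamma_centred \<tau> (A + 1) k x - \<tau> * gamma_centred \<tau> A k x"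
  using powr_add[of x "A - 1" 1] by (auto simp: gamma_centred_def algebra_simps indicator_def)

lemma integrable_gamma_centred: "A > 0 \<Longrightarrow> integrable lborel (gamma_centred \<tau> A k)"
proof (induction k arbitrary: A)
  case 0
  then show ?case
    using gamma_integral[of A] by (simp add: gamma_centred_def[abs_def] has_bochner_integral_iff)
next
  case (Suc k)
  then show ?case
    by (subst gamma_centred_Suc[abs_def]) auto
qed

lemma integral_gamma_centred_Suc:
  "A > 0 \<Longrightarrow> integral\<^sup>L lborel (gamma_centred \<tau> A (Suc k))
    = integral\<^sup>L lborel (gamma_centred \<tau> (A + 1) k) - \<tau> * integral\<^sup>L lborel (gamma_centred \<tau> A k)"
  by (simp add: gamma_centred_Suc[abs_def] integrable_gamma_centred)

text \<open>This is integration by parts for \<open>(x - \<tau>) ^ k * x powr A * exp (- x)\<close>,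
  obtained without differentiating, by induction from \<open>Gamma (A + 1) = A * Gamma A\<close>.
  For \<open>k = 0\<close> the entry \<open>k - 1\<close> is a dummy, killed by its factor.\<close>

lemma integral_gamma_centred_by_parts:
  "A > 0 \<Longrightarrow> integral\<^sup>L lborel (gamma_centred \<tau> (A + 1) k)
    = A * integral\<^sup>L lborel (gamma_centred \<tau> A k) + k * integral\<^sup>L lborel (gamma_centred \<tau> (A + 1) (k - 1))"
proof (induction k arbitrary: A)
  case 0
  have "(\<integral>x. gamma_centred \<tau> A 0 x \<partial>lborel) = Gamma A" if "A > 0" for A
    using gamma_integral[OF that] by (simp add: gamma_centred_def has_bochner_integral_iff)
  moreover have "A \<notin> \<int>\<^sub>\<le>\<^sub>0" using 0 by (auto elim!: nonpos_Ints_cases)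
  ultimately show ?case
    using 0 Gamma_plus1[of A] by simp
next
  case (Suc k)
  define I where "I = (\<lambda>A k. integral\<^sup>L lborel (gamma_centred \<tau> A k))"
  have step: "I A (Suc k) = I (A + 1) k - \<tau> * I A k" if "A > 0" for A k
    using integral_gamma_centred_Suc[OF that] by (simp add: I_def)
  have IH: "I (A + 1) k = A * I A k + k * I (A + 1) (k - 1)" if "A > 0" for A
    using Suc.IH[OF that] by (simp add: I_def)
  have k: "k * I (A + 1 + 1) (k - 1) = k * (I (A + 1) k + \<tau> * I (A + 1) (k - 1))"
    using step[of "A + 1" "k - 1"] Suc.prems by (cases k) auto
  have "I (A + 1) (Suc k) = A * I (A + 1) k + I (A + 1) k + k * I (A + 1 + 1) (k - 1) - \<tau> * I (A + 1) k"
    using step[of "A + 1" k] IH[of "A + 1"] Suc.prems by (simp add: algebra_simps)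
  also have "\<tau> * I (A + 1) k = \<tau> * (A * I A k + k * I (A + 1) (k - 1))"
    by (simp only: IH[OF Suc.prems])
  finally have "I (A + 1) (Suc k) = A * I A (Suc k) + Suc k * I (A + 1) k"
    unfolding k step[OF Suc.prems] by (simp add: algebra_simps)
  then show ?case by (simp add: I_def)
qed

text \<open>Combining the raising step in \<open>k\<close> with the by-parts identity eliminates
  \<open>A + 1\<close>, so all terms live at one parameter. That parameter will carry the tilt:
  \<open>A = a + 1 + \<beta>\<close>.\<close>

lemma gamma_centred_recurrence:
  assumes "A > 0"
  shows "integral\<^sup>L lborel (gamma_centred \<tau> A (Suc k))
    = (A - \<tau> + k) * integral\<^sup>L lborel (gamma_centred \<tau> A k) + k * \<tau> * integral\<^sup>L lborel (gamma_centred \<tau> A (k - 1))"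
proof -
  have "k * integral\<^sup>L lborel (gamma_centred \<tau> (A + 1) (k - 1))
     = k * (integral\<^sup>L lborel (gamma_centred \<tau> A k) + \<tau> * integral\<^sup>L lborel (gamma_centred \<tau> A (k - 1)))"
    using integral_gamma_centred_Suc[OF assms, where k = "k - 1"] by (cases k) auto
  then show ?thesis
    using integral_gamma_centred_Suc[OF assms, of _ k] integral_gamma_centred_by_parts[OF assms, of _ k]
    by (simp add: algebra_simps)
qed

text \<open>Here \<open>x\<close> grows like \<open>c / eps \<tau>\<close> and
  \<open>\<delta>\<close> stays bounded, so the quadratic Stirling term disappears. Multiplying by
  \<open>(eps \<tau> * x \<tau>) powr \<delta> \<tau>\<close>, which tends to
  \<open>c powr d\<close>, trades powers of \<open>x\<close> for powers of
  \<open>eps \<tau>\<close>.\<close>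

lemma Gamma_quotient_tendsto_bounded:
  assumes "((\<lambda>\<tau>. eps \<tau> * x \<tau>) \<longlongrightarrow> c) at_top" "c > 0" "(\<delta> \<longlongrightarrow> d) at_top"
  shows "((\<lambda>\<tau>. Gamma (x \<tau> + \<delta> \<tau>) / Gamma (x \<tau>) * eps \<tau> powr \<delta> \<tau>) \<longlongrightarrow> c powr d) at_top"
    and "\<forall>\<^sub>F \<tau> in at_top. x \<tau> > 0 \<and> x \<tau> + \<delta> \<tau> > 0"
proof -
  have x: "filterlim x at_top at_top"
    by (rule filterlim_at_top_of_eps[OF assms(1,2)])
  have "((\<lambda>\<tau>. (\<delta> \<tau>)\<^sup>2 * inverse (x \<tau>)) \<longlongrightarrow> d\<^sup>2 * 0) at_top"
    by (intro tendsto_intros assms(3) tendsto_inverse_0_at_top x)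
  then have \<delta>: "((\<lambda>\<tau>. (\<delta> \<tau>)\<^sup>2 / x \<tau>) \<longlongrightarrow> 0) at_top" by (simp add: divide_inverse)
  note G = Gamma_quotient_tendsto[OF x \<delta>]
  show "\<forall>\<^sub>F \<tau> in at_top. x \<tau> > 0 \<and> x \<tau> + \<delta> \<tau> > 0" by (fact G(1))
  have "((\<lambda>\<tau>. Gamma (x \<tau> + \<delta> \<tau>) / (Gamma (x \<tau>) * x \<tau> powr \<delta> \<tau>) * (eps \<tau> * x \<tau>) powr \<delta> \<tau>)
     \<longlongrightarrow> exp (0 / 2) * c powr d) at_top"
    using assms by (intro tendsto_mult G(2) tendsto_powr) auto
  moreover have "\<forall>\<^sub>F \<tau> in at_top. Gamma (x \<tau> + \<delta> \<tau>) / (Gamma (x \<tau>) * x \<tau> powr \<delta> \<tau>) * (eps \<tau> * x \<tau>) powr \<delta> \<tau>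
      = Gamma (x \<tau> + \<delta> \<tau>) / Gamma (x \<tau>) * eps \<tau> powr \<delta> \<tau>"
    using G(1) eventually_eps_pos by eventually_elim (simp add: powr_mult)
  ultimately show "((\<lambda>\<tau>. Gamma (x \<tau> + \<delta> \<tau>) / Gamma (x \<tau>) * eps \<tau> powr \<delta> \<tau>) \<longlongrightarrow> c powr d) at_top"
    by (simp add: Lim_transform_eventually)
qed

text \<open>Mass of \<open>beta_kernel a b\<close>: the case \<open>s = 0\<close>,
  \<open>k = 0\<close> of \<open>beta_moment\<close>.\<close>

definition beta_norm :: "real \<Rightarrow> real \<Rightarrow> real" where
  "beta_norm a b = Gamma (a + 1) / Gamma (b + 1)"

text \<open>Integral of \<open>u ^ k * exp (- \<xi> * u)\<close> against the gamma density of shape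
  \<open>d\<close> and rate \<open>\<rho>\<close>. The closed form also makes sense at
  \<open>d = 0\<close>, where it gives the moments of a point mass at 0.\<close>

definition exponential_moment :: "real \<Rightarrow> real \<Rightarrow> real \<Rightarrow> nat \<Rightarrow> real" where
  "exponential_moment \<rho> d \<xi> k = pochhammer d k * \<rho> powr d / (\<rho> + \<xi>) powr (d + k)"

text \<open>Two Gamma quotients are involved: at \<open>a + 1\<close> with increment
  \<open>b - a\<close>, and at \<open>y\<close> with increment \<open>b - a + k\<close>. Their
  powers of \<open>eps \<tau>\<close> differ by exactly \<open>eps \<tau> ^ k\<close>, the scale of
  \<open>(1 - u) ^ k\<close>. The shift \<open>n\<close> covers the exponents raised by the binomial
  expansion; \<open>eps \<tau> * n\<close> tends to 0, so the limit is free of it.\<close>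

lemma beta_moment_tendsto:
  fixes n k :: nat
  assumes a: "((\<lambda>\<tau>. eps \<tau> * (a \<tau> + 1)) \<longlongrightarrow> \<rho>) at_top" "\<rho> > 0"
    and b: "((\<lambda>\<tau>. b \<tau> - a \<tau>) \<longlongrightarrow> d) at_top"
    and \<beta>: "((\<lambda>\<tau>. eps \<tau> * \<beta> \<tau>) \<longlongrightarrow> \<xi>) at_top" "\<rho> + \<xi> > 0"
  shows "((\<lambda>\<tau>. Gamma (a \<tau> + (\<beta> \<tau> + n) + 1) * pochhammer (b \<tau> - a \<tau>) k
            / Gamma (b \<tau> + (\<beta> \<tau> + n) + 1 + k) / eps \<tau> ^ k / beta_norm (a \<tau>) (b \<tau>))
      \<longlongrightarrow> exponential_moment \<rho> d \<xi> k) at_top"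
    and "\<forall>\<^sub>F \<tau> in at_top. a \<tau> + (\<beta> \<tau> + n) + 1 > 0"
proof -
  define y where "y = (\<lambda>\<tau>. a \<tau> + (\<beta> \<tau> + n) + 1)"
  have "((\<lambda>\<tau>. eps \<tau> * (a \<tau> + 1) + eps \<tau> * \<beta> \<tau> + eps \<tau> * real n) \<longlongrightarrow> \<rho> + \<xi> + 0 * real n) at_top"
    by (intro tendsto_intros a \<beta> eps_tendsto_0)
  then have y: "((\<lambda>\<tau>. eps \<tau> * y \<tau>) \<longlongrightarrow> \<rho> + \<xi>) at_top"
    by (simp add: y_def algebra_simps)
  have bk: "((\<lambda>\<tau>. (b \<tau> - a \<tau>) + real k) \<longlongrightarrow> d + real k) at_top"
    by (intro tendsto_intros b)
  note G1 = Gamma_quotient_tendsto_bounded[OF a b]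
  note G2 = Gamma_quotient_tendsto_bounded[OF y \<beta>(2) bk]
  show "\<forall>\<^sub>F \<tau> in at_top. a \<tau> + (\<beta> \<tau> + n) + 1 > 0"
    using G2(2) by eventually_elim (simp add: y_def)
  have poch: "((\<lambda>\<tau>. pochhammer (b \<tau> - a \<tau>) k) \<longlongrightarrow> pochhammer d k) at_top"
    unfolding pochhammer_prod by (intro tendsto_intros b)
  have "((\<lambda>\<tau>. pochhammer (b \<tau> - a \<tau>) k
        * (Gamma (a \<tau> + 1 + (b \<tau> - a \<tau>)) / Gamma (a \<tau> + 1) * eps \<tau> powr (b \<tau> - a \<tau>))
        / (Gamma (y \<tau> + ((b \<tau> - a \<tau>) + real k)) / Gamma (y \<tau>) * eps \<tau> powr ((b \<tau> - a \<tau>) + real k)))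
      \<longlongrightarrow> pochhammer d k * \<rho> powr d / (\<rho> + \<xi>) powr (d + real k)) at_top"
    by (intro tendsto_divide tendsto_mult poch G1(1) G2(1)) (use \<beta>(2) in auto)
  then show "((\<lambda>\<tau>. Gamma (a \<tau> + (\<beta> \<tau> + n) + 1) * pochhammer (b \<tau> - a \<tau>) k
            / Gamma (b \<tau> + (\<beta> \<tau> + n) + 1 + k) / eps \<tau> ^ k / beta_norm (a \<tau>) (b \<tau>))
      \<longlongrightarrow> exponential_moment \<rho> d \<xi> k) at_top"
    unfolding exponential_moment_def
  proof (rule Lim_transform_eventually)
    show "\<forall>\<^sub>F \<tau> in at_top. pochhammer (b \<tau> - a \<tau>) k
        * (Gamma (a \<tau> + 1 + (b \<tau> - a \<tau>)) / Gamma (a \<tau> + 1) * eps \<tau> powr (b \<tau> - a \<tau>))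
        / (Gamma (y \<tau> + ((b \<tau> - a \<tau>) + real k)) / Gamma (y \<tau>) * eps \<tau> powr ((b \<tau> - a \<tau>) + real k))
      = Gamma (a \<tau> + (\<beta> \<tau> + n) + 1) * pochhammer (b \<tau> - a \<tau>) k
            / Gamma (b \<tau> + (\<beta> \<tau> + n) + 1 + k) / eps \<tau> ^ k / beta_norm (a \<tau>) (b \<tau>)"
      using eventually_eps_pos
    proof eventually_elim
      case (elim \<tau>)
      have e1: "a \<tau> + 1 + (b \<tau> - a \<tau>) = b \<tau> + 1"
        and e2: "y \<tau> + ((b \<tau> - a \<tau>) + real k) = b \<tau> + (\<beta> \<tau> + n) + 1 + k"
        by (auto simp: y_def)
      have "eps \<tau> powr ((b \<tau> - a \<tau>) + real k) = eps \<tau> powr (b \<tau> - a \<tau>) * eps \<tau> ^ k"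
        using elim by (simp add: powr_add powr_realpow)
      then show ?case
        unfolding e1 e2 using elim by (simp add: beta_norm_def y_def mult_ac)
    qed
  qed
qed

section \<open>Raw moments of the tilted normal density\<close>

definition normal_mixed :: "real \<Rightarrow> real \<Rightarrow> nat \<Rightarrow> nat \<Rightarrow> real \<Rightarrow> real" where
  "normal_mixed \<mu> \<sigma> j k x = normal_density \<mu> \<sigma> x * ((x - \<mu>) ^ j * x ^ k)"

text \<open>Central powers have known moments, raw powers are wanted; both are carried so that a raw
  power can be exchanged for a central one.\<close>

lemma normal_mixed_Suc:
  "normal_mixed \<mu> \<sigma> j (Suc k) x = normal_mixed \<mu> \<sigma> (Suc j) k x + \<mu> * normal_mixed \<mu> \<sigma> j k x"
  by (simp add: normal_mixed_def algebra_simps)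

lemma integrable_normal_mixed:
  assumes "\<sigma> > 0"
  shows "integrable lborel (normal_mixed \<mu> \<sigma> j k)"
proof (induction k arbitrary: j)
  case 0
  then show ?case
    using integrable_normal_moment[OF assms] by (simp add: normal_mixed_def[abs_def])
next
  case (Suc k)
  then show ?case
    by (subst normal_mixed_Suc[abs_def]) auto
qed

lemma integral_normal_mixed_Suc:
  assumes "\<sigma> > 0"
  shows "integral\<^sup>L lborel (normal_mixed \<mu> \<sigma> j (Suc k))
    = integral\<^sup>L lborel (normal_mixed \<mu> \<sigma> (Suc j) k) + \<mu> * integral\<^sup>L lborel (normal_mixed \<mu> \<sigma> j k)"
  by (simp add: normal_mixed_Suc[abs_def] integrable_normal_mixed[OF assms])

text \<open>Stein's identity for the function \<open>(x - \<mu>) ^ j * x ^ k\<close>. The base case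
  reads it off the explicit central moments; raw powers are then added one at a time. Where
  \<open>j - 1\<close> or \<open>k - 1\<close> is truncated, the term has factor 0.\<close>

lemma integral_normal_mixed_by_parts:
  assumes \<sigma>: "\<sigma> > 0"
  shows "integral\<^sup>L lborel (normal_mixed \<mu> \<sigma> (Suc j) k)
    = \<sigma>\<^sup>2 * (j * integral\<^sup>L lborel (normal_mixed \<mu> \<sigma> (j - 1) k) + k * integral\<^sup>L lborel (normal_mixed \<mu> \<sigma> j (k - 1)))"
proof (induction k arbitrary: j)
  case 0
  have even: "integral\<^sup>L lborel (normal_mixed \<mu> \<sigma> (2 * i) 0) = fact (2 * i) / ((2 / \<sigma>\<^sup>2) ^ i * fact i)" for i
    using normal_moment_even[OF \<sigma>, of \<mu> i] by (simp add: normal_mixed_def[abs_def] has_bochner_integral_iff)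
  have odd: "integral\<^sup>L lborel (normal_mixed \<mu> \<sigma> (2 * i + 1) 0) = 0" for i
    using normal_moment_odd[OF \<sigma>, of \<mu> i] by (simp add: normal_mixed_def[abs_def] has_bochner_integral_iff)
  show ?case
  proof (cases "even j")
    case True
    then obtain i where i: "j = 2 * i" by (elim evenE)
    show ?thesis
    proof (cases i)
      case 0
      then show ?thesis using odd[of 0] i by simp
    next
      case (Suc l)
      then have "Suc j = 2 * i + 1" "j - 1 = 2 * l + 1" using i by auto
      then show ?thesis by (simp only: odd) simp
    qed
  next
    case False
    then obtain i where i: "j = 2 * i + 1" by (elim oddE)
    then have j: "Suc j = 2 * Suc i" "j - 1 = 2 * i" "real j = 2 * real i + 1" by auto
    define P where "P = 2 / \<sigma>\<^sup>2"
    have P: "P > 0" "\<sigma>\<^sup>2 = 2 / P" using \<sigma> by (simp_all add: P_def)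
    \<comment> \<open>The ratio of consecutive even central moments is
      \<open>(2 * i + 1) * \<sigma>\<^sup>2\<close>.\<close>
    have "(fact (2 * Suc i) :: real) / (P ^ Suc i * fact (Suc i))
        = ((2 * real i + 1) * (2 * (real i + 1)) * fact (2 * i)) / (P * P ^ i * ((real i + 1) * fact i))"
      by (simp add: algebra_simps)
    also have "\<dots> = 2 / P * ((2 * real i + 1) * (fact (2 * i) / (P ^ i * fact i)))"
      using P(1) by (simp add: divide_simps)
    finally show ?thesis
      unfolding j even P(2) P_def[symmetric] by (simp add: P_def[symmetric] P(2))
  qed
next
  case (Suc k)
  define N where "N = (\<lambda>j k. integral\<^sup>L lborel (normal_mixed \<mu> \<sigma> j k))"
  have step: "N j (Suc k) = N (Suc j) k + \<mu> * N j k" for j k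
    using integral_normal_mixed_Suc[OF \<sigma>] by (simp add: N_def)
  have IH: "N (Suc j) k = \<sigma>\<^sup>2 * (j * N (j - 1) k + k * N j (k - 1))" for j
    using Suc.IH by (simp add: N_def)
  have k: "k * N j k = k * (N (Suc j) (k - 1) + \<mu> * N j (k - 1))"
    using step[of j "k - 1"] by (cases k) auto
  have j: "j * N (j - 1) (Suc k) = j * (N j k + \<mu> * N (j - 1) k)"
    using step[of "j - 1" k] by (cases j) auto
  have "N (Suc j) (Suc k) = \<sigma>\<^sup>2 * ((j + 1) * N j k + k * N (Suc j) (k - 1))
      + \<mu> * (\<sigma>\<^sup>2 * (j * N (j - 1) k + k * N j (k - 1)))"
    unfolding step[of "Suc j"] using IH[of "Suc j"] IH[of j] by simp
  also have "\<dots> = \<sigma>\<^sup>2 * (j * (N j k + \<mu> * N (j - 1) k) + N j k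
      + k * (N (Suc j) (k - 1) + \<mu> * N j (k - 1)))"
    by (simp add: algebra_simps)
  also have "\<dots> = \<sigma>\<^sup>2 * (j * N (j - 1) (Suc k) + Suc k * N j k)"
    unfolding j[symmetric] k[symmetric] by (simp add: algebra_simps)
  finally show ?case by (simp add: N_def)
qed

definition gauss_moment :: "real \<Rightarrow> real \<Rightarrow> nat \<Rightarrow> real" where
  "gauss_moment a \<xi> m = (\<integral>t. t ^ m * exp (\<xi> * t) * gauss a t \<partial>lborel)"

text \<open>Completing the square. Since the variance is \<open>1 / 2\<close>, the tilt moves the
  centre by \<open>\<xi> / 2\<close> and leaves the constant
  \<open>exp (\<xi> * a + \<xi>\<^sup>2 / 4)\<close>.\<close>

lemma gauss_tilt:
  "t ^ m * exp (\<xi> * t) * gauss a t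
     = exp (\<xi> * a + \<xi>\<^sup>2 / 4) * normal_mixed (a + \<xi> / 2) (sqrt (1 / 2)) 0 m t"
proof -
  have "\<xi> * t - (t - a)\<^sup>2 = \<xi> * a + \<xi>\<^sup>2 / 4 - (t - (a + \<xi> / 2))\<^sup>2"
    by (simp add: power2_eq_square field_simps)
  then have "exp (\<xi> * t) * exp (- ((t - a)\<^sup>2)) = exp (\<xi> * a + \<xi>\<^sup>2 / 4) * exp (- ((t - (a + \<xi> / 2))\<^sup>2))"
    by (simp add: exp_add[symmetric])
  moreover have "pi powr (- 1 / 2) = 1 / sqrt pi"
    by (simp only: minus_divide_left[symmetric] powr_minus powr_half_sqrt[OF less_imp_le[OF pi_gt_zero]] inverse_eq_divide)
  moreover have "normal_density (a + \<xi> / 2) (sqrt (1 / 2)) t = 1 / sqrt pi * exp (- ((t - (a + \<xi> / 2))\<^sup>2))"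
    by (simp add: normal_density_def)
  ultimately show ?thesis
    by (simp add: normal_mixed_def gauss_def)
qed

lemma integrable_gauss_moment: "integrable lborel (\<lambda>t. t ^ m * exp (\<xi> * t) * gauss a t)"
  unfolding gauss_tilt by (intro integrable_mult_right integrable_normal_mixed) simp

lemma gauss_moment_0: "gauss_moment a \<xi> 0 = exp (\<xi> * a + \<xi>\<^sup>2 / 4)"
proof -
  have "integral\<^sup>L lborel (normal_mixed (a + \<xi> / 2) (sqrt (1 / 2)) 0 0) = 1"
    unfolding normal_mixed_def by simp
  then show ?thesis unfolding gauss_moment_def gauss_tilt by simp
qed

text \<open>Stein's identity with \<open>j = 0\<close> and \<open>\<sigma>\<^sup>2 = 1 / 2\<close>.
  The rescaled gamma recurrence converges to this one coefficient by coefficient.\<close>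

lemma gauss_moment_Suc:
  "gauss_moment a \<xi> (Suc m) = (a + \<xi> / 2) * gauss_moment a \<xi> m + m / 2 * gauss_moment a \<xi> (m - 1)"
proof -
  define \<sigma> :: real where "\<sigma> = sqrt (1 / 2)"
  define N where "N = (\<lambda>j k. integral\<^sup>L lborel (normal_mixed (a + \<xi> / 2) \<sigma> j k))"
  have \<sigma>: "\<sigma> > 0" "\<sigma>\<^sup>2 = 1 / 2" by (simp_all add: \<sigma>_def)
  have "N 0 (Suc m) = N 1 m + (a + \<xi> / 2) * N 0 m"
    using integral_normal_mixed_Suc[OF \<sigma>(1)] by (simp add: N_def)
  also have "N 1 m = m / 2 * N 0 (m - 1)"
    using integral_normal_mixed_by_parts[OF \<sigma>(1), of "a + \<xi> / 2" 0 m] \<sigma>(2) by (simp add: N_def)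
  finally show ?thesis
    unfolding gauss_moment_def gauss_tilt
    by (simp only: integral_mult_right_zero \<sigma>_def[symmetric]) (simp add: N_def algebra_simps)
qed

section \<open>Convergence of the gamma factor\<close>

lemma moment_test_gamma_weight:
  assumes "\<tau> > 0"
  shows "moment_test \<tau> \<beta> m x * gamma_weight a x
      = inverse (\<tau> powr \<beta> * (\<tau> * eps \<tau>) ^ m) * gamma_centred \<tau> (a + 1 + \<beta>) m x"
proof (cases "x > 0")
  case True
  have "(x / \<tau> - 1) / eps \<tau> = (x - \<tau>) / (\<tau> * eps \<tau>)"
    using assms by (simp add: field_simps)
  then show ?thesis
    using assms True by (simp add: moment_test_def gamma_weight_def gamma_centred_def powr_divide powr_add
        power_divide field_simps)
qed (simp add: moment_test_def gamma_centred_def)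

lemma integrable_moment_test_gamma_weight:
  assumes "\<tau> > 0" "a + 1 + \<beta> > 0"
  shows "integrable lborel (\<lambda>x. moment_test \<tau> \<beta> m x * gamma_weight a x)"
  unfolding moment_test_gamma_weight[OF assms(1)]
  by (intro integrable_mult_right integrable_gamma_centred assms)

text \<open>The tilt only changes the gamma parameter to \<open>a + 1 + \<beta>\<close>, so the
  recurrence at fixed parameter applies and is divided by
  \<open>(\<tau> * eps \<tau>) ^ Suc m\<close>.\<close>

lemma gamma_moment_recurrence:
  fixes \<tau> \<beta> a :: real
  defines "M \<equiv> \<lambda>m. \<integral>x. moment_test \<tau> \<beta> m x * gamma_weight a x \<partial>lborel"
  assumes "\<tau> > 0" "a + 1 + \<beta> > 0"
  shows "M 0 = Gamma (a + 1 + \<beta>) / \<tau> powr \<beta>"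
    and "M (Suc m) = (a + 1 + \<beta> - \<tau> + m) / (\<tau> * eps \<tau>) * M m + m / 2 * M (m - 1)"
proof -
  have e: "eps \<tau> > 0" by (rule eps_pos[OF assms(2)])
  define I where "I = (\<lambda>m. integral\<^sup>L lborel (gamma_centred \<tau> (a + 1 + \<beta>) m))"
  have M: "M m = inverse (\<tau> powr \<beta> * (\<tau> * eps \<tau>) ^ m) * I m" for m
    unfolding M_def moment_test_gamma_weight[OF assms(2)] by (simp add: I_def)
  have "I 0 = Gamma (a + 1 + \<beta>)"
    using gamma_integral[OF assms(3)] by (simp add: I_def gamma_centred_def[abs_def] has_bochner_integral_iff)
  then show "M 0 = Gamma (a + 1 + \<beta>) / \<tau> powr \<beta>"
    by (simp add: M field_simps)
  have "I (Suc m) = (a + 1 + \<beta> - \<tau> + m) * I m + m * \<tau> * I (m - 1)"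
    unfolding I_def by (rule gamma_centred_recurrence[OF assms(3)])
  \<comment> \<open>The last term drops two orders, and
    \<open>\<tau> / (\<tau> * eps \<tau>)\<^sup>2 = 1 / 2\<close>.\<close>
  moreover have "\<tau> * inverse ((\<tau> * eps \<tau>) ^ Suc m) * I (m - 1) = inverse ((\<tau> * eps \<tau>) ^ (m - 1)) * I (m - 1) / 2" if "m \<noteq> 0"
  proof -
    have "(\<tau> * eps \<tau>) ^ Suc m = (\<tau> * eps \<tau>) ^ (m - 1) * (\<tau> * (\<tau> * (eps \<tau>)\<^sup>2))"
      using that by (cases m) (simp_all add: power2_eq_square)
    then show ?thesis using assms(2) e by (simp add: eps_square field_simps)
  qed
  ultimately have "M (Suc m) = inverse (\<tau> powr \<beta> * (\<tau> * eps \<tau>) ^ Suc m) * ((a + 1 + \<beta> - \<tau> + m) * I m)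
      + m * inverse (\<tau> powr \<beta>) * (inverse ((\<tau> * eps \<tau>) ^ (m - 1)) * I (m - 1) / 2)"
    unfolding M by (cases "m = 0") (simp_all only: inverse_mult_distrib distrib_left mult_ac, simp_all)
  then show "M (Suc m) = (a + 1 + \<beta> - \<tau> + m) / (\<tau> * eps \<tau>) * M m + m / 2 * M (m - 1)"
    unfolding M[of m] M[of "m - 1"] by (simp only: power_Suc inverse_mult_distrib divide_inverse mult_ac)
qed

text \<open>The shift \<open>a + 1 + \<beta> - \<tau>\<close> is on the scale
  \<open>sqrt \<tau>\<close>, so the moment of order 0 is the regime in which Stirling's quadratic
  term survives; higher moments follow by matching the two recurrences.\<close>

lemma gamma_moment_tendsto:
  fixes a \<beta> :: "real \<Rightarrow> real"
  assumes a: "(\<lambda>\<tau>. a \<tau> + 1 - (\<tau> + sqrt (2 * \<tau>) * ahat)) \<in> O[at_top](\<lambda>_. 1)"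
    and \<beta>: "((\<lambda>\<tau>. eps \<tau> * \<beta> \<tau>) \<longlongrightarrow> \<xi>) at_top"
  shows "\<forall>\<^sub>F \<tau> in at_top. a \<tau> + 1 + \<beta> \<tau> > 0"
    and "((\<lambda>\<tau>. (\<integral>x. moment_test \<tau> (\<beta> \<tau>) m x * gamma_weight (a \<tau>) x \<partial>lborel) / Gamma (a \<tau> + 1))
      \<longlongrightarrow> gauss_moment ahat \<xi> m) at_top"
proof -
  have scale: "\<tau> * eps \<tau> = sqrt (2 * \<tau>)" if "\<tau> > 0" for \<tau> :: real
    using that by (simp add: eps_def real_sqrt_divide real_sqrt_mult field_simps)
  have "(\<lambda>\<tau>. 1 / sqrt (2 * \<tau>)) \<in> O[at_top](\<lambda>\<tau>. 1 / sqrt (2 * \<tau>))" by simp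
  from landau_o.big.mult[OF a this]
  have "(\<lambda>\<tau>. (a \<tau> + 1 - (\<tau> + sqrt (2 * \<tau>) * ahat)) * (1 / sqrt (2 * \<tau>))) \<in> O[at_top](\<lambda>\<tau>. 1 / sqrt (2 * \<tau>))"
    by simp
  also have "(\<lambda>\<tau>. 1 / sqrt (2 * \<tau>)) \<in> o[at_top](\<lambda>_. 1::real)"
    by real_asymp
  finally have "((\<lambda>\<tau>. (a \<tau> + 1 - (\<tau> + sqrt (2 * \<tau>) * ahat)) * (1 / sqrt (2 * \<tau>))) \<longlongrightarrow> 0) at_top"
    by (auto dest: smalloD_tendsto)
  from tendsto_add[OF this tendsto_const[of ahat]]
  have "((\<lambda>\<tau>. (a \<tau> + 1 - (\<tau> + sqrt (2 * \<tau>) * ahat)) * (1 / sqrt (2 * \<tau>)) + ahat) \<longlongrightarrow> ahat) at_top" by simp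
  moreover have "\<forall>\<^sub>F \<tau> in at_top. (a \<tau> + 1 - (\<tau> + sqrt (2 * \<tau>) * ahat)) * (1 / sqrt (2 * \<tau>)) + ahat
      = (a \<tau> + 1 - \<tau>) / (\<tau> * eps \<tau>)"
    using eventually_gt_at_top[of 0] by eventually_elim (simp add: scale field_simps)
  ultimately have lim_a: "((\<lambda>\<tau>. (a \<tau> + 1 - \<tau>) / (\<tau> * eps \<tau>)) \<longlongrightarrow> ahat) at_top"
    by (rule Lim_transform_eventually)
  \<comment> \<open>The tilt contributes
    \<open>\<beta> / (\<tau> * eps \<tau>) = eps \<tau> * \<beta> / 2\<close>, by
    \<open>eps_square\<close>; this is the displacement \<open>\<xi> / 2\<close> of the tilted
    Gaussian.\<close>
  have "((\<lambda>\<tau>. (a \<tau> + 1 - \<tau>) / (\<tau> * eps \<tau>) + eps \<tau> * \<beta> \<tau> / 2) \<longlongrightarrow> ahat + \<xi> / 2) at_top"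
    by (intro tendsto_intros lim_a \<beta>) simp
  moreover have "\<forall>\<^sub>F \<tau> in at_top. (a \<tau> + 1 - \<tau>) / (\<tau> * eps \<tau>) + eps \<tau> * \<beta> \<tau> / 2
      = (a \<tau> + 1 + \<beta> \<tau> - \<tau>) / (\<tau> * eps \<tau>)"
    using eventually_eps_pos
  proof eventually_elim
    case (elim \<tau>)
    then have "\<beta> \<tau> / (\<tau> * eps \<tau>) = eps \<tau> * \<beta> \<tau> / (\<tau> * (eps \<tau>)\<^sup>2)"
      by (simp add: power2_eq_square)
    then have "\<beta> \<tau> / (\<tau> * eps \<tau>) = eps \<tau> * \<beta> \<tau> / 2" using elim by (simp add: eps_square)
    then show ?case by (simp add: add_divide_distrib diff_divide_distrib)
  qed
  ultimately have lim_b: "((\<lambda>\<tau>. (a \<tau> + 1 + \<beta> \<tau> - \<tau>) / (\<tau> * eps \<tau>)) \<longlongrightarrow> ahat + \<xi> / 2) at_top"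
    by (rule Lim_transform_eventually)
  \<comment> \<open>The scale satisfies \<open>(\<tau> * eps \<tau>)\<^sup>2 = 2 * \<tau>\<close>,
    so a standardized limit \<open>l\<close> becomes \<open>L = 2 * l\<^sup>2\<close> in
    \<open>Gamma_quotient_tendsto\<close>.\<close>
  have sq: "((\<lambda>\<tau>. (c \<tau>)\<^sup>2 / \<tau>) \<longlongrightarrow> 2 * l\<^sup>2) at_top"
    if "((\<lambda>\<tau>. c \<tau> / (\<tau> * eps \<tau>)) \<longlongrightarrow> l) at_top" for c :: "real \<Rightarrow> real" and l
  proof -
    have "((\<lambda>\<tau>. 2 * (c \<tau> / (\<tau> * eps \<tau>))\<^sup>2) \<longlongrightarrow> 2 * l\<^sup>2) at_top"
      by (intro tendsto_intros that)
    moreover have "\<forall>\<^sub>F \<tau> in at_top. 2 * (c \<tau> / (\<tau> * eps \<tau>))\<^sup>2 = (c \<tau>)\<^sup>2 / \<tau>"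
      using eventually_eps_pos
    proof eventually_elim
      case (elim \<tau>)
      have "(\<tau> * eps \<tau>)\<^sup>2 = 2 * \<tau>" using elim by (simp add: scale)
      then show ?case using elim by (simp add: power_divide)
    qed
    ultimately show ?thesis by (rule Lim_transform_eventually)
  qed
  note GA = Gamma_quotient_tendsto[OF filterlim_ident sq[OF lim_a]]
  note GB = Gamma_quotient_tendsto[OF filterlim_ident sq[OF lim_b]]
  show pos: "\<forall>\<^sub>F \<tau> in at_top. a \<tau> + 1 + \<beta> \<tau> > 0"
    using GB(1) by eventually_elim simp
  \<comment> \<open>Both Gamma values are compared with \<open>Gamma \<tau>\<close>; the exponents
    leave \<open>(ahat + \<xi> / 2)\<^sup>2 - ahat\<^sup>2 = \<xi> * ahat + \<xi>\<^sup>2 /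
    4\<close>.\<close>
  have "((\<lambda>\<tau>. (Gamma (\<tau> + (a \<tau> + 1 + \<beta> \<tau> - \<tau>)) / (Gamma \<tau> * \<tau> powr (a \<tau> + 1 + \<beta> \<tau> - \<tau>)))
         / (Gamma (\<tau> + (a \<tau> + 1 - \<tau>)) / (Gamma \<tau> * \<tau> powr (a \<tau> + 1 - \<tau>))))
       \<longlongrightarrow> exp (2 * (ahat + \<xi> / 2)\<^sup>2 / 2) / exp (2 * ahat\<^sup>2 / 2)) at_top"
    by (intro tendsto_divide GA(2) GB(2)) simp
  also have "exp (2 * (ahat + \<xi> / 2)\<^sup>2 / 2) / exp (2 * ahat\<^sup>2 / 2) = gauss_moment ahat \<xi> 0"
    unfolding gauss_moment_0 exp_diff[symmetric] by (simp add: power2_eq_square field_simps)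
  finally have lim0: "((\<lambda>\<tau>. Gamma (a \<tau> + 1 + \<beta> \<tau>) / \<tau> powr \<beta> \<tau> / Gamma (a \<tau> + 1)) \<longlongrightarrow> gauss_moment ahat \<xi> 0) at_top"
  proof (rule Lim_transform_eventually)
    show "\<forall>\<^sub>F \<tau> in at_top. (Gamma (\<tau> + (a \<tau> + 1 + \<beta> \<tau> - \<tau>)) / (Gamma \<tau> * \<tau> powr (a \<tau> + 1 + \<beta> \<tau> - \<tau>)))
         / (Gamma (\<tau> + (a \<tau> + 1 - \<tau>)) / (Gamma \<tau> * \<tau> powr (a \<tau> + 1 - \<tau>)))
       = Gamma (a \<tau> + 1 + \<beta> \<tau>) / \<tau> powr \<beta> \<tau> / Gamma (a \<tau> + 1)"
      using eventually_gt_at_top[of 0] GA(1)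
    proof eventually_elim
      case (elim \<tau>)
      have "\<tau> powr (a \<tau> + 1 + \<beta> \<tau> - \<tau>) = \<tau> powr \<beta> \<tau> * \<tau> powr (a \<tau> + 1 - \<tau>)"
        using elim by (simp add: powr_add[symmetric] algebra_simps)
      moreover have "Gamma \<tau> \<noteq> 0" using elim by (metis Gamma_real_pos less_irrefl)
      ultimately show ?case using elim by (simp add: add_ac)
    qed
  qed
  define M where "M = (\<lambda>m \<tau>. (\<integral>x. moment_test \<tau> (\<beta> \<tau>) m x * gamma_weight (a \<tau>) x \<partial>lborel) / Gamma (a \<tau> + 1))"
  \<comment> \<open>The recurrence reaches back two steps, hence the pair; at \<open>m = 0\<close>
    truncated subtraction makes both components the same.\<close>
  have "(M m \<longlongrightarrow> gauss_moment ahat \<xi> m) at_top \<and> (M (m - 1) \<longlongrightarrow> gauss_moment ahat \<xi> (m - 1)) at_top"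
  proof (induction m)
    case 0
    have "(M 0 \<longlongrightarrow> gauss_moment ahat \<xi> 0) at_top"
      using lim0
    proof (rule Lim_transform_eventually)
      show "\<forall>\<^sub>F \<tau> in at_top. Gamma (a \<tau> + 1 + \<beta> \<tau>) / \<tau> powr \<beta> \<tau> / Gamma (a \<tau> + 1) = M 0 \<tau>"
        using eventually_gt_at_top[of 0] pos
        by eventually_elim (simp add: M_def gamma_moment_recurrence(1))
    qed
    then show ?case by simp
  next
    case (Suc m)
    have "((\<lambda>\<tau>. 1 / (\<tau> * eps \<tau>)) \<longlongrightarrow> 0) at_top"
      unfolding eps_def by real_asymp
    from tendsto_add[OF lim_b tendsto_mult[OF tendsto_const[of "real m"] this]]
    have "((\<lambda>\<tau>. (a \<tau> + 1 + \<beta> \<tau> - \<tau> + m) / (\<tau> * eps \<tau>)) \<longlongrightarrow> ahat + \<xi> / 2) at_top"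
      by (simp add: add_divide_distrib)
    then have "((\<lambda>\<tau>. (a \<tau> + 1 + \<beta> \<tau> - \<tau> + m) / (\<tau> * eps \<tau>) * M m \<tau> + m / 2 * M (m - 1) \<tau>)
        \<longlongrightarrow> (ahat + \<xi> / 2) * gauss_moment ahat \<xi> m + m / 2 * gauss_moment ahat \<xi> (m - 1)) at_top"
      using Suc.IH by (intro tendsto_intros) auto
    then have "(M (Suc m) \<longlongrightarrow> gauss_moment ahat \<xi> (Suc m)) at_top"
      unfolding gauss_moment_Suc
    proof (rule Lim_transform_eventually)
      show "\<forall>\<^sub>F \<tau> in at_top. (a \<tau> + 1 + \<beta> \<tau> - \<tau> + m) / (\<tau> * eps \<tau>) * M m \<tau> + m / 2 * M (m - 1) \<tau> = M (Suc m) \<tau>"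
        using eventually_gt_at_top[of 0] pos
        by eventually_elim (simp add: M_def gamma_moment_recurrence(2) add_divide_distrib)
    qed
    then show ?case using Suc.IH by simp
  qed
  then show "((\<lambda>\<tau>. (\<integral>x. moment_test \<tau> (\<beta> \<tau>) m x * gamma_weight (a \<tau>) x \<partial>lborel) / Gamma (a \<tau> + 1))
      \<longlongrightarrow> gauss_moment ahat \<xi> m) at_top"
    by (simp add: M_def)
qed

subsection \<open>Convolution operators acting on moments\<close>

lemma borel_measurable_beta_kernel [measurable]: "beta_kernel a b \<in> borel_measurable borel"
  unfolding beta_kernel_def by measurable

lemma borel_measurable_gamma_weight [measurable]: "gamma_weight a \<in> borel_measurable borel"
  unfolding gamma_weight_def by measurable

lemma borel_measurable_gauss [measurable]: "gauss a \<in> borel_measurable borel"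
  unfolding gauss_def by measurable

lemma borel_measurable_mellin_conv [measurable]:
  assumes [measurable]: "f \<in> borel_measurable borel" "g \<in> borel_measurable borel"
  shows "mellin_conv f g \<in> borel_measurable borel"
  unfolding mellin_conv_def set_lebesgue_integral_def by measurable

lemma borel_measurable_K_op [measurable]:
  assumes [measurable]: "f \<in> borel_measurable borel"
  shows "K_op \<rho> d f \<in> borel_measurable borel"
  unfolding K_op_def set_lebesgue_integral_def by measurable

lemma borel_measurable_foldr:
  assumes "\<And>h g. g \<in> borel_measurable borel \<Longrightarrow> T h g \<in> borel_measurable borel" "g \<in> borel_measurable borel"
  shows "foldr T hs g \<in> borel_measurable borel"
  by (induction hs) (auto intro: assms)

text \<open>If \<open>y\<close> has coordinate \<open>t\<close>, then \<open>u * y\<close> has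
  coordinate \<open>u * t - (1 - u) / eps \<tau>\<close>. The factor \<open>u ^ (m - k)\<close> is
  stored in the real power of \<open>u\<close>, so that every coefficient is an integrand of
  \<open>beta_moment\<close>.\<close>

lemma moment_test_mult:
  assumes "\<tau> > 0" "u > 0"
  shows "moment_test \<tau> \<beta> m (u * y) = (\<Sum>k\<le>m. of_nat (m choose k)
      * ((-1) ^ k * (((1 - u) / eps \<tau>) ^ k * u powr (\<beta> + real (m - k)))) * moment_test \<tau> \<beta> (m - k) y)"
proof (cases "y > 0")
  case True
  define t where "t = (y / \<tau> - 1) / eps \<tau>"
  define v where "v = (1 - u) / eps \<tau>"
  have "(u * y / \<tau> - 1) / eps \<tau> = - v + u * t"
    by (simp add: t_def v_def diff_divide_distrib[symmetric] add_divide_distrib[symmetric] algebra_simps)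
  then have "moment_test \<tau> \<beta> m (u * y) = (- v + u * t) ^ m * (u powr \<beta> * (y / \<tau>) powr \<beta>)"
    using assms True by (simp add: moment_test_def powr_mult powr_divide)
  also have "(- v + u * t) ^ m = (\<Sum>k\<le>m. of_nat (m choose k) * (- v) ^ k * (u * t) ^ (m - k))"
    by (rule binomial_ring)
  also have "\<dots> * (u powr \<beta> * (y / \<tau>) powr \<beta>) = (\<Sum>k\<le>m. of_nat (m choose k)
      * ((-1) ^ k * (v ^ k * u powr (\<beta> + real (m - k)))) * (t ^ (m - k) * (y / \<tau>) powr \<beta>))"
    unfolding sum_distrib_right
  proof (intro sum.cong refl)
    fix k
    have "(- v) ^ k = (-1) ^ k * v ^ k" by (rule power_minus)
    then show "of_nat (m choose k) * (- v) ^ k * (u * t) ^ (m - k) * (u powr \<beta> * (y / \<tau>) powr \<beta>)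
      = of_nat (m choose k) * ((-1) ^ k * (v ^ k * u powr (\<beta> + real (m - k)))) * (t ^ (m - k) * (y / \<tau>) powr \<beta>)"
      using assms by (simp only: powr_add powr_realpow power_mult_distrib mult_ac)
  qed
  finally show ?thesis using True by (simp add: moment_test_def t_def v_def)
next
  case False
  then have "\<not> u * y > 0" using assms by (simp add: zero_less_mult_iff)
  then show ?thesis using False by (simp add: moment_test_def)
qed

text \<open>The coefficients \<open>c k\<close> are signed beta moments with
  \<open>s = \<beta> + (m - k)\<close>. Since \<open>m - k\<close> is nonnegative, the single
  condition \<open>a + \<beta> + 1 > 0\<close> makes all of them finite.\<close>

lemma moment_mellin_conv:
  fixes a b \<beta> \<tau> :: real and m :: nat
  defines "c \<equiv> \<lambda>k. (-1) ^ k * (Gamma (a + (\<beta> + real (m - k)) + 1) * pochhammer (b - a) k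
      / Gamma (b + (\<beta> + real (m - k)) + 1 + k) / eps \<tau> ^ k)"
  assumes [measurable]: "g \<in> borel_measurable borel"
    and "\<tau> > 0" "a < b" "a + \<beta> + 1 > 0"
    and g: "\<And>k. k \<le> m \<Longrightarrow> integrable lborel (\<lambda>y. moment_test \<tau> \<beta> k y * g y)"
  shows "integrable lborel (\<lambda>x. moment_test \<tau> \<beta> m x * mellin_conv (beta_kernel a b) g x)"
    and "(\<integral>x. moment_test \<tau> \<beta> m x * mellin_conv (beta_kernel a b) g x \<partial>lborel)
      = (\<Sum>k\<le>m. of_nat (m choose k) * c k * (\<integral>y. moment_test \<tau> \<beta> (m - k) y * g y \<partial>lborel))"
proof -
  define f where "f = (\<lambda>u. indicator {0<..} u * beta_kernel a b u)"
  define A where "A = (\<lambda>k u. (-1) ^ k * (((1 - u) / eps \<tau>) ^ k * u powr (\<beta> + real (m - k))))"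
  have [measurable]: "f \<in> borel_measurable borel" unfolding f_def by measurable
  have conv: "mellin_conv (beta_kernel a b) g x = (\<integral>u. f u * g ((x - 0) / u) / u \<partial>lborel)" for x
    by (simp add: mellin_conv_def set_lebesgue_integral_def f_def mult.assoc)
  have pos: "u > 0" if "f u \<noteq> 0" for u using that by (auto simp: f_def indicator_def split: if_splits)
  have fA: "has_bochner_integral lborel (\<lambda>u. f u * A k u) (c k)" for k
  proof -
    have "a + (\<beta> + real (m - k)) + 1 > 0" using assms by simp
    from has_bochner_integral_mult_right[OF beta_moment[OF \<open>a < b\<close> this, of "eps \<tau>" k], of "(-1) ^ k"]
    show ?thesis by (simp add: f_def A_def c_def mult_ac)
  qed
  have expand: "moment_test \<tau> \<beta> m (0 + u * y) = (\<Sum>k\<le>m. of_nat (m choose k) * A k u * moment_test \<tau> \<beta> (m - k) y)"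
    if "f u \<noteq> 0" for u y
    using moment_test_mult[OF \<open>\<tau> > 0\<close> pos[OF that]] by (simp add: A_def)
  note mc = moment_convolution[where f = f and g = g and P = "moment_test \<tau> \<beta>" and m = m and c = "\<lambda>u. u"
      and s = "\<lambda>_. 0" and A = A, OF _ _ _ _ _ pos expand _ g]
  show "integrable lborel (\<lambda>x. moment_test \<tau> \<beta> m x * mellin_conv (beta_kernel a b) g x)"
    unfolding conv by (rule mc(1)) (use fA in \<open>auto simp: has_bochner_integral_iff\<close>)
  have "(\<integral>x. moment_test \<tau> \<beta> m x * mellin_conv (beta_kernel a b) g x \<partial>lborel)
      = (\<Sum>k\<le>m. of_nat (m choose k) * (\<integral>u. f u * A k u \<partial>lborel) * (\<integral>y. moment_test \<tau> \<beta> (m - k) y * g y \<partial>lborel))"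
    unfolding conv by (rule mc(2)) (use fA in \<open>auto simp: has_bochner_integral_iff\<close>)
  then show "(\<integral>x. moment_test \<tau> \<beta> m x * mellin_conv (beta_kernel a b) g x \<partial>lborel)
      = (\<Sum>k\<le>m. of_nat (m choose k) * c k * (\<integral>y. moment_test \<tau> \<beta> (m - k) y * g y \<partial>lborel))"
    by (simp add: has_bochner_integral_integral_eq[OF fA])
qed

text \<open>Scaling by the tilted rate \<open>\<rho> + \<xi>\<close> reduces this to Euler's Gamma
  integral; positivity of that rate is what the theorem assumes as
  \<open>\<xi> i + \<rho> h > 0\<close>.\<close>

lemma has_bochner_integral_exponential_moment:
  assumes "\<rho> > 0" "d > 0" "\<rho> + \<xi> > 0"
  shows "has_bochner_integral lborel
     (\<lambda>u. indicator {0<..} u * (\<rho> powr d / Gamma d * u powr (d - 1) * exp (- \<rho> * u)) * (u ^ k * exp (- \<xi> * u)))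
     (exponential_moment \<rho> d \<xi> k)"
proof -
  define l where "l = \<rho> + \<xi>"
  have l: "l > 0" using assms by (simp add: l_def)
  have dk: "d + real k > 0" using assms by simp
  have "has_bochner_integral lborel
      (\<lambda>u. indicator {0<..} (0 + l * u) * ((0 + l * u) powr (d + k - 1) * exp (- (0 + l * u))))
      (Gamma (d + k) /\<^sub>R \<bar>l\<bar>)"
    using gamma_integral[OF dk] l by (subst (asm) lborel_has_bochner_integral_real_affine_iff[of l _ _ 0]) auto
  from has_bochner_integral_mult_right[OF this, of "\<rho> powr d / Gamma d / l powr (d + k - 1)"]
  have "has_bochner_integral lborel
      (\<lambda>u. \<rho> powr d / Gamma d / l powr (d + k - 1) * (indicator {0<..} (0 + l * u) * ((0 + l * u) powr (d + k - 1) * exp (- (0 + l * u)))))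
      (\<rho> powr d / Gamma d / l powr (d + k - 1) * (Gamma (d + k) /\<^sub>R \<bar>l\<bar>))" by simp
  moreover have "\<rho> powr d / Gamma d / l powr (d + k - 1) * (indicator {0<..} (0 + l * u) * ((0 + l * u) powr (d + k - 1) * exp (- (0 + l * u))))
     = indicator {0<..} u * (\<rho> powr d / Gamma d * u powr (d - 1) * exp (- \<rho> * u)) * (u ^ k * exp (- \<xi> * u))" for u
  proof (cases "u > 0")
    case True
    have "(l * u) powr (d + k - 1) = l powr (d + k - 1) * (u powr (d - 1) * u ^ k)"
      using True l by (simp add: powr_mult powr_realpow[symmetric] powr_add[symmetric] algebra_simps)
    moreover have "exp (- (l * u)) = exp (- \<rho> * u) * exp (- \<xi> * u)"
      by (simp add: l_def exp_add[symmetric] algebra_simps)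
    ultimately show ?thesis using True l by simp
  next
    case False
    then have "\<not> l * u > 0" using l by (simp add: zero_less_mult_iff)
    then show ?thesis using False by simp
  qed
  moreover have "\<rho> powr d / Gamma d / l powr (d + k - 1) * (Gamma (d + k) /\<^sub>R \<bar>l\<bar>) = exponential_moment \<rho> d \<xi> k"
  proof -
    have "l powr (d + k - 1) * l = l powr (d + k)"
      using l powr_add[of l "d + k - 1" 1] by simp
    moreover have "pochhammer d k = Gamma (d + k) / Gamma d"
      using assms by (intro pochhammer_Gamma) (auto elim!: nonpos_Ints_cases)
    ultimately show ?thesis
      using l by (simp add: exponential_moment_def l_def[symmetric] divide_inverse mult_ac inverse_mult_distrib[symmetric])
  qed
  ultimately show ?thesis by simp
qed

lemma exponential_moment_0:
  assumes "\<rho> > 0" "\<rho> + \<xi> > 0"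
  shows "exponential_moment \<rho> 0 \<xi> k = (if k = 0 then 1 else 0)"
  using assms by (auto simp: exponential_moment_def pochhammer_0_left)

text \<open>\<open>K_op\<close> evaluates \<open>g\<close> at \<open>y = t + u\<close>, so
  \<open>t = y - u\<close>: hence the signs \<open>(-1) ^ k\<close> and the tilt
  \<open>exp (- \<xi> * u)\<close>. For \<open>d = 0\<close> the operator is the identity, in
  accordance with \<open>exponential_moment_0\<close>.\<close>

lemma moment_K_op:
  fixes \<rho> d \<xi> :: real and m :: nat
  assumes [measurable]: "g \<in> borel_measurable borel"
    and pos: "\<rho> > 0" "d \<ge> 0" "\<rho> + \<xi> > 0"
    and g: "\<And>k. integrable lborel (\<lambda>t. t ^ k * exp (\<xi> * t) * g t)"
  shows "integrable lborel (\<lambda>t. t ^ m * exp (\<xi> * t) * K_op \<rho> d g t)"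
    and "(\<integral>t. t ^ m * exp (\<xi> * t) * K_op \<rho> d g t \<partial>lborel)
      = (\<Sum>k\<le>m. of_nat (m choose k) * ((-1) ^ k * exponential_moment \<rho> d \<xi> k)
           * (\<integral>t. t ^ (m - k) * exp (\<xi> * t) * g t \<partial>lborel))"
proof -
  have "integrable lborel (\<lambda>t. t ^ m * exp (\<xi> * t) * K_op \<rho> d g t)
    \<and> (\<integral>t. t ^ m * exp (\<xi> * t) * K_op \<rho> d g t \<partial>lborel)
      = (\<Sum>k\<le>m. of_nat (m choose k) * ((-1) ^ k * exponential_moment \<rho> d \<xi> k)
           * (\<integral>t. t ^ (m - k) * exp (\<xi> * t) * g t \<partial>lborel))"
  proof (cases "d = 0")
    case True
    have "(\<Sum>k\<le>m. of_nat (m choose k) * ((-1) ^ k * exponential_moment \<rho> d \<xi> k)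
           * (\<integral>t. t ^ (m - k) * exp (\<xi> * t) * g t \<partial>lborel))
        = (\<Sum>k\<le>m. if k = 0 then (\<integral>t. t ^ m * exp (\<xi> * t) * g t \<partial>lborel) else 0)"
      using True pos by (intro sum.cong) (auto simp: exponential_moment_0)
    then show ?thesis using True g by (simp add: K_op_def)
  next
    case False
    define f where "f = (\<lambda>u. indicator {0<..} u * (\<rho> powr d / Gamma d * u powr (d - 1) * exp (- \<rho> * u)))"
    define A where "A = (\<lambda>k u. (-1) ^ k * (u ^ k * exp (- \<xi> * u)))"
    define P where "P = (\<lambda>k t. t ^ k * exp (\<xi> * t))"
    have [measurable]: "f \<in> borel_measurable borel" "P k \<in> borel_measurable borel" for k
      unfolding f_def P_def by measurable
    have conv: "K_op \<rho> d g t = (\<integral>u. f u * g ((t - (- u)) / 1) / 1 \<partial>lborel)" for t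
      unfolding K_op_def set_lebesgue_integral_def f_def real_scaleR_def
      by (simp only: False if_False mult.assoc diff_minus_eq_add div_by_1)
    have fA: "has_bochner_integral lborel (\<lambda>u. f u * A k u) ((-1) ^ k * exponential_moment \<rho> d \<xi> k)" for k
    proof -
      have "d > 0" using False pos by simp
      from has_bochner_integral_mult_right[OF has_bochner_integral_exponential_moment[OF pos(1) this pos(3)], of "(-1) ^ k" k]
      show ?thesis by (simp add: f_def A_def mult_ac)
    qed
    have expand: "P m (- u + 1 * y) = (\<Sum>k\<le>m. of_nat (m choose k) * A k u * P (m - k) y)" for u y
    proof -
      have "P m (- u + 1 * y) = (\<Sum>k\<le>m. of_nat (m choose k) * (- u) ^ k * y ^ (m - k)) * exp (\<xi> * (- u + y))"
        by (simp only: P_def mult_1 binomial_ring)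
      also have "exp (\<xi> * (- u + y)) = exp (- \<xi> * u) * exp (\<xi> * y)"
        by (simp add: exp_add[symmetric] algebra_simps)
      finally show ?thesis
        unfolding sum_distrib_right power_minus[of u] A_def P_def by (simp only: mult_ac)
    qed
    note mc = moment_convolution[where f = f and g = g and P = P and m = m and c = "\<lambda>_. 1"
        and s = "\<lambda>u. - u" and A = A, OF _ _ _ _ _ _ expand]
    have "integrable lborel (\<lambda>t. P m t * K_op \<rho> d g t)"
      unfolding conv by (rule mc(1)) (use fA g in \<open>auto simp: has_bochner_integral_iff P_def\<close>)
    moreover have "(\<integral>t. P m t * K_op \<rho> d g t \<partial>lborel)
      = (\<Sum>k\<le>m. of_nat (m choose k) * (\<integral>u. f u * A k u \<partial>lborel) * (\<integral>y. P (m - k) y * g y \<partial>lborel))"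
      unfolding conv by (rule mc(2)) (use fA g in \<open>auto simp: has_bochner_integral_iff P_def\<close>)
    ultimately show ?thesis
      by (simp add: has_bochner_integral_integral_eq[OF fA] P_def)
  qed
  then show "integrable lborel (\<lambda>t. t ^ m * exp (\<xi> * t) * K_op \<rho> d g t)"
    and "(\<integral>t. t ^ m * exp (\<xi> * t) * K_op \<rho> d g t \<partial>lborel)
      = (\<Sum>k\<le>m. of_nat (m choose k) * ((-1) ^ k * exponential_moment \<rho> d \<xi> k)
           * (\<integral>t. t ^ (m - k) * exp (\<xi> * t) * g t \<partial>lborel))" by auto
qed

section \<open>Moment sequences as formal power series\<close>

definition moment_fps :: "(nat \<Rightarrow> real) \<Rightarrow> real fps" where
  "moment_fps \<mu> = Abs_fps (\<lambda>m. \<mu> m / fact m)"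

lemma moment_fps_nth: "fps_nth (moment_fps \<mu>) m = \<mu> m / fact m"
  by (simp add: moment_fps_def)

lemma moment_fps_mult_nth:
  "fact m * fps_nth (moment_fps \<kappa> * moment_fps \<mu>) m = (\<Sum>k\<le>m. of_nat (m choose k) * \<kappa> k * \<mu> (m - k))"
  unfolding fps_mult_nth sum_distrib_left moment_fps_nth atLeast0AtMost
  by (intro sum.cong refl) (simp add: binomial_fact field_simps)

text \<open>Formally the expansion of \<open>(\<rho> / (\<rho> + \<xi> + z)) powr d\<close> in
  powers of \<open>z\<close>.\<close>

definition exponential_fps :: "real \<Rightarrow> real \<Rightarrow> real \<Rightarrow> real fps" where
  "exponential_fps \<rho> d \<xi> = moment_fps (\<lambda>k. (-1) ^ k * exponential_moment \<rho> d \<xi> k)"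

text \<open>Powers of one base multiply by adding exponents; on coefficients this is the Vandermonde
  identity for Pochhammer symbols. It turns a parameter raised by one into one further
  factor.\<close>

lemma exponential_fps_add:
  assumes "\<rho> > 0" "\<rho> + \<xi> > 0"
  shows "exponential_fps \<rho> d \<xi> * exponential_fps \<rho> e \<xi> = exponential_fps \<rho> (d + e) \<xi>"
proof (rule fps_ext)
  fix m
  have "fact m * fps_nth (exponential_fps \<rho> d \<xi> * exponential_fps \<rho> e \<xi>) m
     = (\<Sum>k\<le>m. (-1) ^ m * \<rho> powr (d + e) / (\<rho> + \<xi>) powr (d + e + m)
          * (of_nat (m choose k) * pochhammer d k * pochhammer e (m - k)))"
    unfolding exponential_fps_def moment_fps_mult_nth
  proof (intro sum.cong refl)
    fix k assume "k \<in> {..m}"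
    then have k: "k \<le> m" by simp
    have "(-1 :: real) ^ k * (-1) ^ (m - k) = (-1) ^ m"
      using k by (simp flip: power_add)
    moreover have "(\<rho> + \<xi>) powr (d + k) * (\<rho> + \<xi>) powr (e + real (m - k)) = (\<rho> + \<xi>) powr (d + e + m)"
      using k by (simp flip: powr_add add: algebra_simps of_nat_diff)
    moreover have "\<rho> powr (d + e) = \<rho> powr d * \<rho> powr e" by (rule powr_add)
    ultimately show "of_nat (m choose k) * ((-1) ^ k * exponential_moment \<rho> d \<xi> k) * ((-1) ^ (m - k) * exponential_moment \<rho> e \<xi> (m - k))
      = (-1) ^ m * \<rho> powr (d + e) / (\<rho> + \<xi>) powr (d + e + m) * (of_nat (m choose k) * pochhammer d k * pochhammer e (m - k))"
      unfolding exponential_moment_def by (simp flip: \<open>_ = (-1 :: real) ^ m\<close> \<open>_ = (\<rho> + \<xi>) powr (d + e + m)\<close>)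
  qed
  also have "\<dots> = fact m * fps_nth (exponential_fps \<rho> (d + e) \<xi>) m"
    unfolding sum_distrib_left[symmetric] pochhammer_binomial_sum[symmetric]
    by (simp add: exponential_fps_def moment_fps_nth exponential_moment_def)
  finally show "fps_nth (exponential_fps \<rho> d \<xi> * exponential_fps \<rho> e \<xi>) m = fps_nth (exponential_fps \<rho> (d + e) \<xi>) m"
    by simp
qed

lemma K_op_moment_fps:
  assumes "g \<in> borel_measurable borel" "\<rho> > 0" "d \<ge> 0" "\<rho> + \<xi> > 0"
    and "\<And>k. integrable lborel (\<lambda>t. t ^ k * exp (\<xi> * t) * g t)"
  shows "moment_fps (\<lambda>m. \<integral>t. t ^ m * exp (\<xi> * t) * K_op \<rho> d g t \<partial>lborel)
    = exponential_fps \<rho> d \<xi> * moment_fps (\<lambda>m. \<integral>t. t ^ m * exp (\<xi> * t) * g t \<partial>lborel)"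
proof (rule fps_ext)
  fix m
  have "fact m * fps_nth (exponential_fps \<rho> d \<xi> * moment_fps (\<lambda>m. \<integral>t. t ^ m * exp (\<xi> * t) * g t \<partial>lborel)) m
     = (\<integral>t. t ^ m * exp (\<xi> * t) * K_op \<rho> d g t \<partial>lborel)"
    unfolding exponential_fps_def moment_fps_mult_nth moment_K_op(2)[OF assms] ..
  then show "fps_nth (moment_fps (\<lambda>m. \<integral>t. t ^ m * exp (\<xi> * t) * K_op \<rho> d g t \<partial>lborel)) m
    = fps_nth (exponential_fps \<rho> d \<xi> * moment_fps (\<lambda>m. \<integral>t. t ^ m * exp (\<xi> * t) * g t \<partial>lborel)) m"
    unfolding moment_fps_nth by (simp add: field_simps)
qed

lemma foldr_K_op_moments:
  fixes \<rho> d :: "'a \<Rightarrow> real" and \<xi> a :: real and hs :: "'a list"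
  assumes "\<And>h. h \<in> set hs \<Longrightarrow> \<rho> h > 0 \<and> d h \<ge> 0 \<and> \<rho> h + \<xi> > 0"
  defines "F \<equiv> foldr (\<lambda>h. K_op (\<rho> h) (d h)) hs (gauss a)"
  shows "integrable lborel (\<lambda>t. t ^ m * exp (\<xi> * t) * F t)"
    and "moment_fps (\<lambda>m. \<integral>t. t ^ m * exp (\<xi> * t) * F t \<partial>lborel)
      = (\<Prod>h\<leftarrow>hs. exponential_fps (\<rho> h) (d h) \<xi>) * moment_fps (gauss_moment a \<xi>)"
proof -
  have "(\<forall>m. integrable lborel (\<lambda>t. t ^ m * exp (\<xi> * t) * foldr (\<lambda>h. K_op (\<rho> h) (d h)) hs (gauss a) t))
     \<and> moment_fps (\<lambda>m. \<integral>t. t ^ m * exp (\<xi> * t) * foldr (\<lambda>h. K_op (\<rho> h) (d h)) hs (gauss a) t \<partial>lborel)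
      = (\<Prod>h\<leftarrow>hs. exponential_fps (\<rho> h) (d h) \<xi>) * moment_fps (gauss_moment a \<xi>)"
    using assms(1)
  proof (induction hs)
    case Nil
    then show ?case by (simp add: integrable_gauss_moment gauss_moment_def[abs_def])
  next
    case (Cons h hs)
    define G where "G = foldr (\<lambda>h. K_op (\<rho> h) (d h)) hs (gauss a)"
    have "G \<in> borel_measurable borel"
      unfolding G_def by (intro borel_measurable_foldr) auto
    moreover have "\<rho> h > 0" "d h \<ge> 0" "\<rho> h + \<xi> > 0" using Cons.prems by auto
    moreover have "\<And>k. integrable lborel (\<lambda>t. t ^ k * exp (\<xi> * t) * G t)"
      using Cons by (simp add: G_def)
    ultimately show ?case
      using Cons moment_K_op(1)[of G "\<rho> h" "d h" \<xi>] K_op_moment_fps[of G "\<rho> h" "d h" \<xi>]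
      by (simp add: G_def mult.assoc)
  qed
  then show "integrable lborel (\<lambda>t. t ^ m * exp (\<xi> * t) * F t)"
    and "moment_fps (\<lambda>m. \<integral>t. t ^ m * exp (\<xi> * t) * F t \<partial>lborel)
      = (\<Prod>h\<leftarrow>hs. exponential_fps (\<rho> h) (d h) \<xi>) * moment_fps (gauss_moment a \<xi>)"
    by (auto simp: F_def)
qed

subsection \<open>Convergence of the moments\<close>

text \<open>\<open>moment_test 1 0 0\<close> is the indicator of the positive axis, so the mass is
  the moment of order 0 and the masses of the factors multiply. This is exact at all admissible
  parameters, not asymptotic.\<close>

lemma foldr_mellin_conv_mass:
  assumes "\<And>h. h \<in> set hs \<Longrightarrow> a h > -1 \<and> b h > a h" "aq > -1"
  shows "has_bochner_integral lborel
      (\<lambda>x. indicator {0<..} x * foldr (\<lambda>h. mellin_conv (beta_kernel (a h) (b h))) hs (gamma_weight aq) x)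
      ((\<Prod>h\<leftarrow>hs. beta_norm (a h) (b h)) * Gamma (aq + 1))"
  using assms
proof (induction hs)
  case Nil
  have eq: "(\<lambda>x. indicator {0<..} x * gamma_weight aq x)
      = (\<lambda>x. indicator {0<..} x * (x powr (aq + 1 - 1) * exp (- x)))"
    by (auto simp: gamma_weight_def indicator_def)
  have "has_bochner_integral lborel (\<lambda>x. indicator {0<..} x * gamma_weight aq x) (Gamma (aq + 1))"
    unfolding eq by (rule gamma_integral) (use Nil in simp)
  then show ?case by simp
next
  case (Cons h hs)
  define g where "g = foldr (\<lambda>h. mellin_conv (beta_kernel (a h) (b h))) hs (gamma_weight aq)"
  have g: "g \<in> borel_measurable borel"
    unfolding g_def by (intro borel_measurable_foldr) auto
  have test: "moment_test 1 0 0 x = indicator {0<..} x" for x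
    by (simp add: moment_test_def indicator_def)
  have IH: "has_bochner_integral lborel (\<lambda>x. moment_test 1 0 0 x * g x) ((\<Prod>h\<leftarrow>hs. beta_norm (a h) (b h)) * Gamma (aq + 1))"
    unfolding test g_def using Cons by simp
  have *: "integrable lborel (\<lambda>x. moment_test 1 0 k x * g x)" if "k \<le> 0" for k
    using IH that by (simp add: has_bochner_integral_iff)
  have ab: "a h < b h" "a h + 0 + 1 > 0" using Cons.prems(1)[of h] by auto
  have "has_bochner_integral lborel (\<lambda>x. moment_test 1 0 0 x * mellin_conv (beta_kernel (a h) (b h)) g x)
     (beta_norm (a h) (b h) * ((\<Prod>h\<leftarrow>hs. beta_norm (a h) (b h)) * Gamma (aq + 1)))"
    using moment_mellin_conv[OF g zero_less_one ab *] has_bochner_integral_integral_eq[OF IH]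
    by (simp add: has_bochner_integral_iff beta_norm_def)
  then show ?case unfolding test by (simp add: g_def mult.assoc)
qed

text \<open>Induction on the factors with \<open>m\<close> arbitrary, since a moment of order
  \<open>m\<close> uses all lower moments of the shorter convolution. \<open>N\<close> is the
  product of the masses, so each new factor brings its own \<open>beta_norm\<close>.\<close>

lemma foldr_mellin_conv_moments_tendsto:
  fixes a b :: "'a \<Rightarrow> real \<Rightarrow> real" and aq \<beta> :: "real \<Rightarrow> real" and \<rho> d :: "'a \<Rightarrow> real"
    and \<xi> ahat :: real and hs :: "'a list" and m :: nat
  defines "W \<equiv> \<lambda>hs \<tau>. foldr (\<lambda>h. mellin_conv (beta_kernel (a h \<tau>) (b h \<tau>))) hs (gamma_weight (aq \<tau>))"
    and "N \<equiv> \<lambda>hs \<tau>. (\<Prod>h\<leftarrow>hs. beta_norm (a h \<tau>) (b h \<tau>)) * Gamma (aq \<tau> + 1)"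
  assumes ab: "\<And>h. h \<in> set hs \<Longrightarrow> \<forall>\<^sub>F \<tau> in at_top. a h \<tau> > -1 \<and> b h \<tau> > a h \<tau>"
    and a: "\<And>h. h \<in> set hs \<Longrightarrow> ((\<lambda>\<tau>. eps \<tau> * (a h \<tau> + 1)) \<longlongrightarrow> \<rho> h) at_top"
    and b: "\<And>h. h \<in> set hs \<Longrightarrow> ((\<lambda>\<tau>. b h \<tau> - a h \<tau>) \<longlongrightarrow> d h) at_top"
    and \<rho>: "\<And>h. h \<in> set hs \<Longrightarrow> \<rho> h > 0 \<and> \<rho> h + \<xi> > 0"
    and aq: "(\<lambda>\<tau>. aq \<tau> + 1 - (\<tau> + sqrt (2 * \<tau>) * ahat)) \<in> O[at_top](\<lambda>_. 1)"
    and \<beta>: "((\<lambda>\<tau>. eps \<tau> * \<beta> \<tau>) \<longlongrightarrow> \<xi>) at_top"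
  shows "\<forall>\<^sub>F \<tau> in at_top. integrable lborel (\<lambda>x. moment_test \<tau> (\<beta> \<tau>) m x * W hs \<tau> x)"
    and "((\<lambda>\<tau>. (\<integral>x. moment_test \<tau> (\<beta> \<tau>) m x * W hs \<tau> x \<partial>lborel) / N hs \<tau>) \<longlongrightarrow>
      fact m * fps_nth ((\<Prod>h\<leftarrow>hs. exponential_fps (\<rho> h) (d h) \<xi>) * moment_fps (gauss_moment ahat \<xi>)) m) at_top"
proof -
  define R where "R = (\<lambda>hs. (\<Prod>h\<leftarrow>hs. exponential_fps (\<rho> h) (d h) \<xi>) * moment_fps (gauss_moment ahat \<xi>))"
  have "(\<forall>\<^sub>F \<tau> in at_top. integrable lborel (\<lambda>x. moment_test \<tau> (\<beta> \<tau>) m x * W hs \<tau> x)) \<and>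
    ((\<lambda>\<tau>. (\<integral>x. moment_test \<tau> (\<beta> \<tau>) m x * W hs \<tau> x \<partial>lborel) / N hs \<tau>) \<longlongrightarrow> fact m * fps_nth (R hs) m) at_top"
    using ab a b \<rho>
  proof (induction hs arbitrary: m)
    case Nil
    have "\<forall>\<^sub>F \<tau> in at_top. integrable lborel (\<lambda>x. moment_test \<tau> (\<beta> \<tau>) m x * gamma_weight (aq \<tau>) x)"
      using gamma_moment_tendsto(1)[OF aq \<beta>] eventually_gt_at_top[of 0]
      by eventually_elim (simp add: integrable_moment_test_gamma_weight)
    then show ?case
      using gamma_moment_tendsto(2)[OF aq \<beta>, of m] by (simp add: W_def N_def R_def moment_fps_nth)
  next
    case (Cons h hs)
    define q where "q = (\<lambda>k \<tau>. Gamma (a h \<tau> + (\<beta> \<tau> + real (m - k)) + 1) * pochhammer (b h \<tau> - a h \<tau>) k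
      / Gamma (b h \<tau> + (\<beta> \<tau> + real (m - k)) + 1 + k) / eps \<tau> ^ k)"
    define I where "I = (\<lambda>k \<tau>. \<integral>x. moment_test \<tau> (\<beta> \<tau>) k x * W hs \<tau> x \<partial>lborel)"
    have h: "((\<lambda>\<tau>. eps \<tau> * (a h \<tau> + 1)) \<longlongrightarrow> \<rho> h) at_top" "\<rho> h > 0"
      "((\<lambda>\<tau>. b h \<tau> - a h \<tau>) \<longlongrightarrow> d h) at_top" "\<rho> h + \<xi> > 0"
      using Cons.prems by auto
    note bm = beta_moment_tendsto[OF h(1-3) \<beta> h(4)]
    have int: "\<forall>\<^sub>F \<tau> in at_top. integrable lborel (\<lambda>x. moment_test \<tau> (\<beta> \<tau>) k x * W hs \<tau> x)"
      and lim: "((\<lambda>\<tau>. I k \<tau> / N hs \<tau>) \<longlongrightarrow> fact k * fps_nth (R hs) k) at_top" for k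
      using Cons.IH[of k] Cons.prems by (auto simp: I_def)
    have "\<forall>\<^sub>F \<tau> in at_top. \<forall>k\<in>{..m}. integrable lborel (\<lambda>x. moment_test \<tau> (\<beta> \<tau>) k x * W hs \<tau> x)"
      by (intro eventually_ball_finite ballI int) auto
    moreover have "\<forall>\<^sub>F \<tau> in at_top. a h \<tau> > -1 \<and> b h \<tau> > a h \<tau>"
      using Cons.prems by auto
    ultimately have ev: "\<forall>\<^sub>F \<tau> in at_top. integrable lborel (\<lambda>x. moment_test \<tau> (\<beta> \<tau>) m x * W (h # hs) \<tau> x)
        \<and> (\<Sum>k\<le>m. of_nat (m choose k) * ((-1) ^ k * (q k \<tau> / beta_norm (a h \<tau>) (b h \<tau>))) * (I (m - k) \<tau> / N hs \<tau>))
          = (\<integral>x. moment_test \<tau> (\<beta> \<tau>) m x * W (h # hs) \<tau> x \<partial>lborel) / N (h # hs) \<tau>"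
      using eventually_gt_at_top[of 0] bm(2)[of 0]
    proof eventually_elim
      case (elim \<tau>)
      have W: "W hs \<tau> \<in> borel_measurable borel"
        unfolding W_def by (intro borel_measurable_foldr) auto
      have ab: "a h \<tau> < b h \<tau>" "a h \<tau> + \<beta> \<tau> + 1 > 0" using elim by auto
      have W_Cons: "W (h # hs) \<tau> = mellin_conv (beta_kernel (a h \<tau>) (b h \<tau>)) (W hs \<tau>)"
        and N_Cons: "N (h # hs) \<tau> = beta_norm (a h \<tau>) (b h \<tau>) * N hs \<tau>"
        by (simp_all add: W_def N_def)
      note mm = moment_mellin_conv[OF W \<open>\<tau> > 0\<close> ab]
      have "integrable lborel (\<lambda>x. moment_test \<tau> (\<beta> \<tau>) m x * W (h # hs) \<tau> x)"
        unfolding W_Cons by (rule mm(1)) (use elim in auto)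
      moreover have "(\<integral>x. moment_test \<tau> (\<beta> \<tau>) m x * W (h # hs) \<tau> x \<partial>lborel)
          = (\<Sum>k\<le>m. of_nat (m choose k) * ((-1) ^ k * q k \<tau>) * I (m - k) \<tau>)"
        unfolding W_Cons q_def I_def by (rule mm(2)) (use elim in auto)
      ultimately show ?case
        unfolding N_Cons by (simp add: sum_divide_distrib mult_ac)
    qed
    have "((\<lambda>\<tau>. \<Sum>k\<le>m. of_nat (m choose k) * ((-1) ^ k * (q k \<tau> / beta_norm (a h \<tau>) (b h \<tau>))) * (I (m - k) \<tau> / N hs \<tau>))
      \<longlongrightarrow> (\<Sum>k\<le>m. of_nat (m choose k) * ((-1) ^ k * exponential_moment (\<rho> h) (d h) \<xi> k)
            * (fact (m - k) * fps_nth (R hs) (m - k)))) at_top"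
      unfolding q_def by (intro tendsto_intros bm(1) lim)
    also have "(\<Sum>k\<le>m. of_nat (m choose k) * ((-1) ^ k * exponential_moment (\<rho> h) (d h) \<xi> k)
            * (fact (m - k) * fps_nth (R hs) (m - k))) = fact m * fps_nth (R (h # hs)) m"
    proof -
      have "R (h # hs) = exponential_fps (\<rho> h) (d h) \<xi> * R hs"
        by (simp add: R_def mult.assoc)
      \<comment> \<open>Every series is the \<open>moment_fps\<close> of its own coefficients times
        factorials; in this form the product rule yields the limit sum.\<close>
      also have "R hs = moment_fps (\<lambda>k. fact k * fps_nth (R hs) k)"
        by (rule fps_ext) (simp add: moment_fps_nth)
      finally show ?thesis
        by (simp only: exponential_fps_def moment_fps_mult_nth)
    qed
    finally have "((\<lambda>\<tau>. (\<integral>x. moment_test \<tau> (\<beta> \<tau>) m x * W (h # hs) \<tau> x \<partial>lborel) / N (h # hs) \<tau>)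
        \<longlongrightarrow> fact m * fps_nth (R (h # hs)) m) at_top"
      by (rule Lim_transform_eventually) (use ev in eventually_elim, auto)
    then show ?case using ev by (auto elim: eventually_mono)
  qed
  then show "\<forall>\<^sub>F \<tau> in at_top. integrable lborel (\<lambda>x. moment_test \<tau> (\<beta> \<tau>) m x * W hs \<tau> x)"
    and "((\<lambda>\<tau>. (\<integral>x. moment_test \<tau> (\<beta> \<tau>) m x * W hs \<tau> x \<partial>lborel) / N hs \<tau>) \<longlongrightarrow>
      fact m * fps_nth ((\<Prod>h\<leftarrow>hs. exponential_fps (\<rho> h) (d h) \<xi>) * moment_fps (gauss_moment ahat \<xi>)) m) at_top"
    by (auto simp: R_def)
qed

text \<open>Used once for masses, where the factor is \<open>1 / (b j \<tau> + 1)\<close>, and once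
  for limit series, where it is the series of \<open>K_op (\<rho> j) 1\<close>.\<close>

lemma prod_list_update_factor:
  fixes f g :: "'a \<Rightarrow> 'b :: comm_monoid_mult"
  assumes "distinct hs" "j \<in> set hs" "g j = c * f j" "\<And>h. h \<noteq> j \<Longrightarrow> g h = f h"
  shows "(\<Prod>h\<leftarrow>hs. g h) = c * (\<Prod>h\<leftarrow>hs. f h)"
  using assms(1,2)
proof (induction hs)
  case (Cons h hs)
  show ?case
  proof (cases "h = j")
    case True
    then have "g x = f x" if "x \<in> set hs" for x
      using that Cons.prems by (intro assms(4)) auto
    then have "prod_list (map g hs) = prod_list (map f hs)" by (metis (no_types) map_cong)
    then show ?thesis using True assms(3) by (simp add: mult.assoc)
  next
    case False
    then show ?thesis using Cons assms(4)[of h] by (simp add: mult.left_commute)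
  qed
qed simp

section \<open>Locally uniform convergence of the columns\<close>

lemma abs_exp_minus_one_le: "\<bar>exp x - 1\<bar> \<le> exp \<bar>x\<bar> - 1" for x :: real
proof (cases "x \<ge> 0")
  case False
  have "1 + x \<le> exp x" "1 + - x \<le> exp (- x)" by (rule exp_ge_add_one_self)+
  moreover have "exp \<bar>x\<bar> = exp (- x)" "exp x \<le> 1" using False by simp_all
  ultimately show ?thesis by linarith
qed simp

text \<open>The logarithms of the two functions differ by \<open>(eps \<tau> * \<beta> \<tau> -
  \<xi>) * t + \<beta> \<tau> * (ln (1 + z) - z)\<close> with \<open>z = eps \<tau> * t\<close>; the
  second term is at most of order \<open>\<beta> \<tau> * (eps \<tau>)\<^sup>2\<close>, hence of
  order \<open>eps \<tau>\<close>.\<close>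

lemma powr_eps_tendsto_exp:
  assumes \<beta>: "((\<lambda>\<tau>. eps \<tau> * \<beta> \<tau>) \<longlongrightarrow> \<xi>) at_top" and "compact S"
  shows "\<forall>\<^sub>F \<tau> in at_top. \<forall>t\<in>S. 1 + eps \<tau> * t > 0 \<and>
      centre \<tau> powr (- \<beta> \<tau>) * zoom \<tau> t powr \<beta> \<tau> = (1 + eps \<tau> * t) powr \<beta> \<tau>"
    and "uniform_limit S (\<lambda>\<tau> t. (1 + eps \<tau> * t) powr \<beta> \<tau>) (\<lambda>t. exp (\<xi> * t)) at_top"
proof -
  obtain B where B: "B > 0" "\<And>t. t \<in> S \<Longrightarrow> \<bar>t\<bar> \<le> B"
    using compact_imp_bounded[OF \<open>compact S\<close>] unfolding bounded_pos by auto
  have "((\<lambda>\<tau>. eps \<tau> * B) \<longlongrightarrow> 0 * B) at_top"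
    by (intro tendsto_intros eps_tendsto_0)
  \<comment> \<open>The bound \<open>1 / 2\<close> keeps \<open>1 + eps \<tau> * t\<close> positive
    and meets the hypothesis of \<open>abs_ln_one_plus_x_minus_x_bound\<close>.\<close>
  then have "\<forall>\<^sub>F \<tau> in at_top. eps \<tau> * B < 1 / 2"
    by (intro order_tendstoD(2)[of _ 0]) auto
  then have small: "\<forall>\<^sub>F \<tau> in at_top. \<tau> > 0 \<and> eps \<tau> > 0 \<and> (\<forall>t\<in>S. \<bar>eps \<tau> * t\<bar> < 1 / 2)"
    using eventually_eps_pos
  proof eventually_elim
    case (elim \<tau>)
    have "\<bar>eps \<tau> * t\<bar> < 1 / 2" if "t \<in> S" for t
    proof -
      have "\<bar>eps \<tau> * t\<bar> \<le> eps \<tau> * B"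
        using elim B(2)[OF that] by (auto simp: abs_mult intro!: mult_mono)
      then show ?thesis using elim by linarith
    qed
    then show ?case using elim by simp
  qed
  show "\<forall>\<^sub>F \<tau> in at_top. \<forall>t\<in>S. 1 + eps \<tau> * t > 0 \<and>
      centre \<tau> powr (- \<beta> \<tau>) * zoom \<tau> t powr \<beta> \<tau> = (1 + eps \<tau> * t) powr \<beta> \<tau>"
    using small
  proof eventually_elim
    case (elim \<tau>)
    show ?case
    proof
      fix t assume "t \<in> S"
      then have "1 + eps \<tau> * t > 0" using elim by (auto simp: abs_less_iff)
      then show "1 + eps \<tau> * t > 0 \<and>
          centre \<tau> powr (- \<beta> \<tau>) * zoom \<tau> t powr \<beta> \<tau> = (1 + eps \<tau> * t) powr \<beta> \<tau>"
        using elim by (simp add: centre_def zoom_def powr_mult powr_minus)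
    qed
  qed
  \<comment> \<open>Bound for the exponent error on all of \<open>S\<close>: a slope term, and
    \<open>2 * z\<^sup>2\<close> weighted by \<open>\<beta>\<close>, where
    \<open>\<beta> * (eps \<tau>)\<^sup>2\<close> is regrouped as
    \<open>(eps \<tau> * \<beta>) * eps \<tau>\<close> so that the first factor converges.\<close>
  define \<eta> where "\<eta> = (\<lambda>\<tau>. \<bar>eps \<tau> * \<beta> \<tau> - \<xi>\<bar> * B + 2 * \<bar>eps \<tau> * \<beta> \<tau>\<bar> * eps \<tau> * B\<^sup>2)"
  have "(\<eta> \<longlongrightarrow> \<bar>\<xi> - \<xi>\<bar> * B + 2 * \<bar>\<xi>\<bar> * 0 * B\<^sup>2) at_top"
    unfolding \<eta>_def by (intro tendsto_intros \<beta> eps_tendsto_0)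
  then have "((\<lambda>\<tau>. exp (\<bar>\<xi>\<bar> * B) * (exp (\<eta> \<tau>) - 1)) \<longlongrightarrow> exp (\<bar>\<xi>\<bar> * B) * (exp 0 - 1)) at_top"
    by (intro tendsto_intros) simp
  then have lim: "((\<lambda>\<tau>. exp (\<bar>\<xi>\<bar> * B) * (exp (\<eta> \<tau>) - 1)) \<longlongrightarrow> 0) at_top" by simp
  show "uniform_limit S (\<lambda>\<tau> t. (1 + eps \<tau> * t) powr \<beta> \<tau>) (\<lambda>t. exp (\<xi> * t)) at_top"
  proof (rule uniform_limitI)
    fix e :: real assume "e > 0"
    from order_tendstoD(2)[OF lim this] small
    show "\<forall>\<^sub>F \<tau> in at_top. \<forall>t\<in>S. dist ((1 + eps \<tau> * t) powr \<beta> \<tau>) (exp (\<xi> * t)) < e"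
    proof eventually_elim
      case (elim \<tau>)
      show ?case
      proof
        fix t assume t: "t \<in> S"
        define z where "z = eps \<tau> * t"
        have z: "\<bar>z\<bar> \<le> 1 / 2" "1 + z > 0" using elim t by (auto simp: z_def abs_less_iff less_imp_le)
        define \<delta> where "\<delta> = \<beta> \<tau> * ln (1 + z) - \<xi> * t"
        have "\<delta> = (eps \<tau> * \<beta> \<tau> - \<xi>) * t + \<beta> \<tau> * (ln (1 + z) - z)"
          by (simp add: \<delta>_def z_def algebra_simps)
        then have "\<bar>\<delta>\<bar> \<le> \<bar>eps \<tau> * \<beta> \<tau> - \<xi>\<bar> * \<bar>t\<bar> + \<bar>\<beta> \<tau>\<bar> * \<bar>ln (1 + z) - z\<bar>"
          by (metis abs_mult abs_triangle_ineq)
        also have "\<dots> \<le> \<bar>eps \<tau> * \<beta> \<tau> - \<xi>\<bar> * B + \<bar>\<beta> \<tau>\<bar> * (2 * z\<^sup>2)"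
          using abs_ln_one_plus_x_minus_x_bound[OF z(1)] B t by (intro add_mono mult_left_mono) auto
        also have "\<bar>\<beta> \<tau>\<bar> * (2 * z\<^sup>2) \<le> \<bar>\<beta> \<tau>\<bar> * (2 * ((eps \<tau>)\<^sup>2 * B\<^sup>2))"
          using B(2)[OF t] unfolding z_def power_mult_distrib
          by (intro mult_left_mono) (auto simp: abs_le_square_iff[symmetric])
        also have "\<bar>\<beta> \<tau>\<bar> * (2 * ((eps \<tau>)\<^sup>2 * B\<^sup>2)) = 2 * \<bar>eps \<tau> * \<beta> \<tau>\<bar> * eps \<tau> * B\<^sup>2"
          using elim by (simp add: abs_mult power2_eq_square)
        finally have \<delta>: "\<bar>\<delta>\<bar> \<le> \<eta> \<tau>" by (simp add: \<eta>_def)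
        have "(1 + eps \<tau> * t) powr \<beta> \<tau> - exp (\<xi> * t) = exp (\<xi> * t) * (exp \<delta> - 1)"
          unfolding z_def[symmetric] using z(2) by (simp add: powr_def \<delta>_def exp_diff right_diff_distrib)
        then have "dist ((1 + eps \<tau> * t) powr \<beta> \<tau>) (exp (\<xi> * t)) = exp (\<xi> * t) * \<bar>exp \<delta> - 1\<bar>"
          by (simp add: dist_real_def abs_mult)
        also have "\<dots> \<le> exp (\<bar>\<xi>\<bar> * B) * (exp (\<eta> \<tau>) - 1)"
        proof (intro mult_mono)
          have "\<xi> * t \<le> \<bar>\<xi>\<bar> * \<bar>t\<bar>" by (simp flip: abs_mult)
          also have "\<dots> \<le> \<bar>\<xi>\<bar> * B" using B(2)[OF t] by (intro mult_left_mono) auto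
          finally show "exp (\<xi> * t) \<le> exp (\<bar>\<xi>\<bar> * B)" by simp
          show "\<bar>exp \<delta> - 1\<bar> \<le> exp (\<eta> \<tau>) - 1"
            using abs_exp_minus_one_le[of \<delta>] \<delta> by (smt (verit) exp_le_cancel_iff)
        qed auto
        also have "\<dots> < e" using elim by simp
        finally show "dist ((1 + eps \<tau> * t) powr \<beta> \<tau>) (exp (\<xi> * t)) < e" .
      qed
    qed
  qed
qed

text \<open>Rows of both kinds take one form through the parameters \<open>b'\<close>. Since
  \<open>Gamma (b j + 2) = (b j + 1) * Gamma (b j + 1)\<close>, raising \<open>b j\<close> divides
  the mass by \<open>b j + 1\<close>; hence \<open>weight_raised_mass\<close> is the true mass of
  the raised weight, and \<open>N\<close> normalizes every row.\<close>

lemma row_hat_test: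
  fixes a b :: "nat \<Rightarrow> real \<Rightarrow> real" and j r :: nat and \<tau> \<beta> :: real
  defines "b' \<equiv> if j \<le> r then (\<lambda>h. b h \<tau>)(j := b j \<tau> + 1) else (\<lambda>h. b h \<tau>)"
  defines "W \<equiv> weight r (\<lambda>h. a h \<tau>) b'"
    and "N \<equiv> (\<Prod>h\<leftarrow>[1..<Suc r]. beta_norm (a h \<tau>) (b' h)) * Gamma (a (Suc r) \<tau> + 1)"
  assumes "\<tau> > 0" "j \<in> {1..r + 1}"
    and ab: "\<And>h. h \<in> {1..r + 1} \<Longrightarrow> a h \<tau> > -1" "\<And>h. h \<in> {1..r} \<Longrightarrow> b h \<tau> > a h \<tau>"
  shows "indicator {- (1 / eps \<tau>)<..} t * (t ^ m * (1 + eps \<tau> * t) powr \<beta> * row_hat r a b j \<tau> t)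
    = \<tau> * eps \<tau> / N * (moment_test \<tau> \<beta> m (\<tau> + \<tau> * eps \<tau> * t) * W (\<tau> + \<tau> * eps \<tau> * t))"
proof -
  have e: "eps \<tau> > 0" by (rule eps_pos[OF \<open>\<tau> > 0\<close>])
  have mass: "weight_mass r (\<lambda>h. a h \<tau>) (\<lambda>h. b h \<tau>)
      = (\<Prod>h\<leftarrow>[1..<Suc r]. beta_norm (a h \<tau>) (b h \<tau>)) * Gamma (a (Suc r) \<tau> + 1)"
    unfolding weight_mass_def weight_def set_lebesgue_integral_def real_scaleR_def
    by (intro has_bochner_integral_integral_eq foldr_mellin_conv_mass) (use ab in auto)
  have N: "N = (if j \<le> r then weight_raised_mass r (\<lambda>h. a h \<tau>) (\<lambda>h. b h \<tau>) j
      else weight_mass r (\<lambda>h. a h \<tau>) (\<lambda>h. b h \<tau>))"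
  proof (cases "j \<le> r")
    case True
    then have j: "j \<in> {1..r}" using assms(5) by simp
    then have "b j \<tau> + 1 > 0" using ab(1)[of j] ab(2)[of j] by simp
    moreover from this have "b j \<tau> + 1 \<notin> \<int>\<^sub>\<le>\<^sub>0" by (auto elim!: nonpos_Ints_cases)
    ultimately have "beta_norm (a j \<tau>) (b j \<tau> + 1) = 1 / (b j \<tau> + 1) * beta_norm (a j \<tau>) (b j \<tau>)"
      using Gamma_plus1[of "b j \<tau> + 1"] by (simp add: beta_norm_def)
    then have "(\<Prod>h\<leftarrow>[1..<Suc r]. beta_norm (a h \<tau>) (b' h))
        = 1 / (b j \<tau> + 1) * (\<Prod>h\<leftarrow>[1..<Suc r]. beta_norm (a h \<tau>) (b h \<tau>))"
      using True j by (intro prod_list_update_factor[where j = j]) (auto simp: b'_def)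
    then show ?thesis using True by (simp add: N_def weight_raised_mass_def mass)
  qed (simp add: N_def mass b'_def)
  have row: "row_hat r a b j \<tau> t = \<tau> * eps \<tau> / N * W (zoom \<tau> t)"
    by (simp add: row_hat_def Let_def N W_def b'_def weight_raised_def centre_def)
  have zoom: "zoom \<tau> t = \<tau> + \<tau> * eps \<tau> * t"
    by (simp add: zoom_def centre_def algebra_simps)
  have ind: "- (1 / eps \<tau>) < t \<longleftrightarrow> 0 < \<tau> + \<tau> * eps \<tau> * t"
  proof -
    have "0 < \<tau> + \<tau> * eps \<tau> * t \<longleftrightarrow> 0 < \<tau> * (1 + eps \<tau> * t)" by (simp add: algebra_simps)
    also have "\<dots> \<longleftrightarrow> 0 < 1 + eps \<tau> * t"
      using \<open>\<tau> > 0\<close> by (simp add: zero_less_mult_iff)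
    also have "\<dots> \<longleftrightarrow> - (1 / eps \<tau>) < t"
      using e by (auto simp: field_simps)
    finally show ?thesis ..
  qed
  have "(\<tau> + \<tau> * eps \<tau> * t) / \<tau> = 1 + eps \<tau> * t"
    using \<open>\<tau> > 0\<close> by (simp add: field_simps)
  then have "moment_test \<tau> \<beta> m (\<tau> + \<tau> * eps \<tau> * t)
      = t ^ m * (1 + eps \<tau> * t) powr \<beta> * indicator {- (1 / eps \<tau>)<..} t"
    unfolding moment_test_def using e ind by (simp add: indicator_def)
  then show ?thesis by (simp add: row zoom)
qed

theorem corollary5p4:
  fixes r p :: nat
    and a b \<beta> :: "nat \<Rightarrow> real \<Rightarrow> real"
    and \<rho> d \<xi> :: "nat \<Rightarrow> real"
    and ahat :: real
  assumes "p \<ge> 1"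
    and "\<forall>\<^sub>F \<tau> in at_top. (\<forall>\<nu>\<in>{1..r + 1}. a \<nu> \<tau> > -1) \<and> (\<forall>h\<in>{1..r}. b h \<tau> > a h \<tau>)"
    and "(\<lambda>\<tau>. a (r + 1) \<tau> + 1 - (\<tau> + sqrt (2 * \<tau>) * ahat)) \<in> O[at_top](\<lambda>_. 1)"
    and "\<And>h. h \<in> {1..r} \<Longrightarrow> ((\<lambda>\<tau>. eps \<tau> * (a h \<tau> + 1)) \<longlongrightarrow> \<rho> h) at_top"
    and "\<And>h. h \<in> {1..r} \<Longrightarrow> \<rho> h > 0"
    and "\<And>h. h \<in> {1..r} \<Longrightarrow> ((\<lambda>\<tau>. b h \<tau> - a h \<tau>) \<longlongrightarrow> d h) at_top"
    and "\<And>h. h \<in> {1..r} \<Longrightarrow> d h \<ge> 0"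
    and "\<And>i. i \<in> {1..p} \<Longrightarrow> ((\<lambda>\<tau>. eps \<tau> * \<beta> i \<tau>) \<longlongrightarrow> \<xi> i) at_top"
    and "\<And>i h. i \<in> {1..p} \<Longrightarrow> h \<in> {1..r} \<Longrightarrow> \<xi> i + \<rho> h > 0"
  shows "(\<forall>i\<in>{1..p}. \<forall>S. compact S \<longrightarrow>
            (\<forall>\<^sub>F \<tau> in at_top. \<forall>t\<in>S. 1 + eps \<tau> * t > 0 \<and>
               centre \<tau> powr (- \<beta> i \<tau>) * zoom \<tau> t powr \<beta> i \<tau> = (1 + eps \<tau> * t) powr \<beta> i \<tau>) \<and>
            uniform_limit S (\<lambda>\<tau> t. (1 + eps \<tau> * t) powr \<beta> i \<tau>) (\<lambda>t. exp (\<xi> i * t)) at_top)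
       \<and> (\<forall>m::nat. \<forall>i\<in>{1..p}. \<forall>j\<in>{1..r + 1}.
            (\<forall>\<^sub>F \<tau> in at_top. set_integrable lborel {- (1 / eps \<tau>)<..}
               (\<lambda>t. t ^ m * (1 + eps \<tau> * t) powr \<beta> i \<tau> * row_hat r a b j \<tau> t)) \<and>
            integrable lborel (\<lambda>t. t ^ m * exp (\<xi> i * t) * row_lim r \<rho> d ahat j t) \<and>
            ((\<lambda>\<tau>. LINT t:{- (1 / eps \<tau>)<..}|lborel.
                t ^ m * (1 + eps \<tau> * t) powr \<beta> i \<tau> * row_hat r a b j \<tau> t)
             \<longlongrightarrow> (LINT t|lborel. t ^ m * exp (\<xi> i * t) * row_lim r \<rho> d ahat j t)) at_top)"
proof (intro conjI ballI allI impI)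
  fix i S assume i: "i \<in> {1..p}" and S: "compact (S :: real set)"
  show "\<forall>\<^sub>F \<tau> in at_top. \<forall>t\<in>S. 1 + eps \<tau> * t > 0 \<and>
      centre \<tau> powr (- \<beta> i \<tau>) * zoom \<tau> t powr \<beta> i \<tau> = (1 + eps \<tau> * t) powr \<beta> i \<tau>"
    by (rule powr_eps_tendsto_exp(1)[OF assms(8)[OF i] S])
  show "uniform_limit S (\<lambda>\<tau> t. (1 + eps \<tau> * t) powr \<beta> i \<tau>) (\<lambda>t. exp (\<xi> i * t)) at_top"
    by (rule powr_eps_tendsto_exp(2)[OF assms(8)[OF i] S])
next
  fix m i j assume i: "i \<in> {1..p}" and j: "j \<in> {1..r + 1}"
  define hs where "hs = [1..<Suc r]"
  have hs: "set hs = {1..r}" by (auto simp: hs_def)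
  \<comment> \<open>For \<open>j \<le> r\<close> the row is the weight with \<open>b j\<close>
    raised, whose limit exponent is \<open>d j + 1\<close>; for \<open>j = r + 1\<close> nothing
    changes. Thus all rows share one convergence statement with limit \<open>L\<close>.\<close>
  define b' where "b' = (\<lambda>h \<tau>. (if j \<le> r then (\<lambda>h. b h \<tau>)(j := b j \<tau> + 1) else (\<lambda>h. b h \<tau>)) h)"
  define d' where "d' = (if j \<le> r then d(j := d j + 1) else d)"
  define W where "W = (\<lambda>\<tau>. foldr (\<lambda>h. mellin_conv (beta_kernel (a h \<tau>) (b' h \<tau>))) hs (gamma_weight (a (Suc r) \<tau>)))"
  define N where "N = (\<lambda>\<tau>. (\<Prod>h\<leftarrow>hs. beta_norm (a h \<tau>) (b' h \<tau>)) * Gamma (a (Suc r) \<tau> + 1))"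
  define L where "L = fact m * fps_nth ((\<Prod>h\<leftarrow>hs. exponential_fps (\<rho> h) (d' h) (\<xi> i)) * moment_fps (gauss_moment ahat (\<xi> i))) m"
  have pos: "\<rho> h > 0 \<and> \<rho> h + \<xi> i > 0" if "h \<in> set hs" for h
    using that assms(5)[of h] assms(9)[OF i, of h] by (auto simp: hs add.commute)
  have ab: "\<forall>\<^sub>F \<tau> in at_top. a h \<tau> > -1 \<and> b' h \<tau> > a h \<tau>" if "h \<in> set hs" for h
    using assms(2)
  proof eventually_elim
    case (elim \<tau>)
    then have "a h \<tau> > -1" "b h \<tau> > a h \<tau>" using that by (auto simp: hs)
    then show ?case by (auto simp: b'_def)
  qed
  have b': "((\<lambda>\<tau>. b' h \<tau> - a h \<tau>) \<longlongrightarrow> d' h) at_top" if "h \<in> set hs" for h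
  proof -
    have lim: "((\<lambda>\<tau>. b h \<tau> - a h \<tau>) \<longlongrightarrow> d h) at_top" using that assms(6) by (simp add: hs)
    show ?thesis
    proof (cases "j \<le> r \<and> h = j")
      case True
      have "((\<lambda>\<tau>. b h \<tau> - a h \<tau> + 1) \<longlongrightarrow> d h + 1) at_top"
        by (intro tendsto_intros lim)
      then show ?thesis using True by (simp add: b'_def d'_def algebra_simps)
    next
      case False
      then have "b' h = b h" "d' h = d h" by (auto simp: b'_def d'_def)
      then show ?thesis using lim by simp
    qed
  qed
  have aq: "(\<lambda>\<tau>. a (Suc r) \<tau> + 1 - (\<tau> + sqrt (2 * \<tau>) * ahat)) \<in> O[at_top](\<lambda>_. 1)"
    using assms(3) by simp
  have a: "((\<lambda>\<tau>. eps \<tau> * (a h \<tau> + 1)) \<longlongrightarrow> \<rho> h) at_top" if "h \<in> set hs" for h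
    using assms(4) that by (simp add: hs)
  note \<beta> = assms(8)[OF i]
  have moments: "\<forall>\<^sub>F \<tau> in at_top. integrable lborel (\<lambda>x. moment_test \<tau> (\<beta> i \<tau>) m x * W \<tau> x)"
    "((\<lambda>\<tau>. (\<integral>x. moment_test \<tau> (\<beta> i \<tau>) m x * W \<tau> x \<partial>lborel) / N \<tau>) \<longlongrightarrow> L) at_top"
    unfolding W_def N_def L_def
    by (rule foldr_mellin_conv_moments_tendsto(1)[where \<rho> = \<rho> and d = d' and \<xi> = "\<xi> i" and ahat = ahat];
        fact ab a b' pos aq \<beta>)
      (rule foldr_mellin_conv_moments_tendsto(2); fact ab a b' pos aq \<beta>)
  have row: "\<forall>\<^sub>F \<tau> in at_top. \<tau> > 0 \<and> eps \<tau> > 0 \<and>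
      (\<forall>t. indicator {- (1 / eps \<tau>)<..} t * (t ^ m * (1 + eps \<tau> * t) powr \<beta> i \<tau> * row_hat r a b j \<tau> t)
        = \<tau> * eps \<tau> / N \<tau> * (moment_test \<tau> (\<beta> i \<tau>) m (\<tau> + \<tau> * eps \<tau> * t) * W \<tau> (\<tau> + \<tau> * eps \<tau> * t)))"
    using assms(2) eventually_eps_pos
  proof eventually_elim
    case (elim \<tau>)
    have "indicator {- (1 / eps \<tau>)<..} t * (t ^ m * (1 + eps \<tau> * t) powr \<beta> i \<tau> * row_hat r a b j \<tau> t)
        = \<tau> * eps \<tau> / N \<tau> * (moment_test \<tau> (\<beta> i \<tau>) m (\<tau> + \<tau> * eps \<tau> * t) * W \<tau> (\<tau> + \<tau> * eps \<tau> * t))" for t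
      unfolding W_def N_def b'_def hs_def
      by (rule row_hat_test[unfolded weight_def]) (use elim j in auto)
    then show ?case using elim by blast
  qed
  show "\<forall>\<^sub>F \<tau> in at_top. set_integrable lborel {- (1 / eps \<tau>)<..}
      (\<lambda>t. t ^ m * (1 + eps \<tau> * t) powr \<beta> i \<tau> * row_hat r a b j \<tau> t)"
    using moments(1) row
  proof eventually_elim
    case (elim \<tau>)
    from lborel_integrable_real_affine[OF elim(1), of "\<tau> * eps \<tau>" \<tau>]
    show ?case unfolding set_integrable_def using elim(2) by simp
  qed
  \<comment> \<open>The Jacobian of \<open>x = \<tau> + \<tau> * eps \<tau> * t\<close> is the
    prefactor \<open>centre \<tau> * eps \<tau>\<close> of the row.\<close>
  have "\<forall>\<^sub>F \<tau> in at_top. (\<integral>x. moment_test \<tau> (\<beta> i \<tau>) m x * W \<tau> x \<partial>lborel) / N \<tau>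
      = (LINT t:{- (1 / eps \<tau>)<..}|lborel. t ^ m * (1 + eps \<tau> * t) powr \<beta> i \<tau> * row_hat r a b j \<tau> t)"
    using row
  proof eventually_elim
    case (elim \<tau>)
    then show ?case
      unfolding set_lebesgue_integral_def
      by (subst lborel_integral_real_affine[of "\<tau> * eps \<tau>" _ \<tau>]) simp_all
  qed
  from Lim_transform_eventually[OF moments(2) this]
  have lim: "((\<lambda>\<tau>. LINT t:{- (1 / eps \<tau>)<..}|lborel.
      t ^ m * (1 + eps \<tau> * t) powr \<beta> i \<tau> * row_hat r a b j \<tau> t) \<longlongrightarrow> L) at_top" .
  define F where "F = F_lim r \<rho> d ahat"
  have F_eq: "F = foldr (\<lambda>h. K_op (\<rho> h) (d h)) hs (gauss ahat)"
    by (simp add: F_def F_lim_def hs_def)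
  have F_meas: "F \<in> borel_measurable borel"
    unfolding F_eq by (intro borel_measurable_foldr) auto
  have pos_d: "\<rho> h > 0 \<and> d h \<ge> 0 \<and> \<rho> h + \<xi> i > 0" if "h \<in> set hs" for h
    using pos[OF that] assms(7)[of h] that by (simp add: hs)
  have FM: "integrable lborel (\<lambda>t. t ^ k * exp (\<xi> i * t) * F t)"
    "moment_fps (\<lambda>m. \<integral>t. t ^ m * exp (\<xi> i * t) * F t \<partial>lborel)
      = (\<Prod>h\<leftarrow>hs. exponential_fps (\<rho> h) (d h) (\<xi> i)) * moment_fps (gauss_moment ahat (\<xi> i))" for k
    unfolding F_eq by (rule foldr_K_op_moments; fact pos_d)+
  have "(\<forall>m. integrable lborel (\<lambda>t. t ^ m * exp (\<xi> i * t) * row_lim r \<rho> d ahat j t)) \<and>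
     moment_fps (\<lambda>m. \<integral>t. t ^ m * exp (\<xi> i * t) * row_lim r \<rho> d ahat j t \<partial>lborel)
       = (\<Prod>h\<leftarrow>hs. exponential_fps (\<rho> h) (d' h) (\<xi> i)) * moment_fps (gauss_moment ahat (\<xi> i))"
  proof (cases "j \<le> r")
    case True
    then have j_hs: "j \<in> set hs" using j by (simp add: hs)
    have row: "row_lim r \<rho> d ahat j = K_op (\<rho> j) 1 F" using True by (simp add: row_lim_def F_def)
    \<comment> \<open>The raised parameter sits at position \<open>j\<close> inside the product,
      whereas \<open>K_op (\<rho> j) 1\<close> acts outermost; the two agree because the series
      commute.\<close>
    have "exponential_fps (\<rho> j) (d' j) (\<xi> i) = exponential_fps (\<rho> j) 1 (\<xi> i) * exponential_fps (\<rho> j) (d j) (\<xi> i)"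
      using pos[OF j_hs] True by (simp add: exponential_fps_add d'_def add.commute)
    then have "(\<Prod>h\<leftarrow>hs. exponential_fps (\<rho> h) (d' h) (\<xi> i))
        = exponential_fps (\<rho> j) 1 (\<xi> i) * (\<Prod>h\<leftarrow>hs. exponential_fps (\<rho> h) (d h) (\<xi> i))"
      using j_hs by (intro prod_list_update_factor[where j = j]) (auto simp: hs_def d'_def)
    then show ?thesis
      using moment_K_op(1)[OF F_meas _ _ _ FM(1)] K_op_moment_fps[OF F_meas _ _ _ FM(1)] FM(2) pos[OF j_hs]
      by (simp add: row mult.assoc)
  next
    case False
    then show ?thesis using FM by (simp add: row_lim_def F_def d'_def)
  qed
  then have int: "integrable lborel (\<lambda>t. t ^ m * exp (\<xi> i * t) * row_lim r \<rho> d ahat j t)"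
    and "fps_nth (moment_fps (\<lambda>m. \<integral>t. t ^ m * exp (\<xi> i * t) * row_lim r \<rho> d ahat j t \<partial>lborel)) m = L / fact m"
    by (simp_all add: L_def)
  then have "(\<integral>t. t ^ m * exp (\<xi> i * t) * row_lim r \<rho> d ahat j t \<partial>lborel) = L"
    unfolding moment_fps_nth by simp
  with int lim show "integrable lborel (\<lambda>t. t ^ m * exp (\<xi> i * t) * row_lim r \<rho> d ahat j t)"
    and "((\<lambda>\<tau>. LINT t:{- (1 / eps \<tau>)<..}|lborel.
        t ^ m * (1 + eps \<tau> * t) powr \<beta> i \<tau> * row_hat r a b j \<tau> t)
      \<longlongrightarrow> (LINT t|lborel. t ^ m * exp (\<xi> i * t) * row_lim r \<rho> d ahat j t)) at_top"
    by simp_all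
qed

end
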